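(* Let $n\ge2$, let $\Omega\subset\mathbb{R}^n\setminus\{0\}$ be a bounded open set with $\operatorname{dist}(\Omega,\{0\})>0$, let $a\in\mathbb{R}$, and let $p$ satisfy $\frac1p\in\left(0,\frac1n\right)\cup\left(\frac1n,1\right]$. Assume $$\frac1q\in\left[\frac1p-\frac1n,\ \frac1p\right],$$ and let $b\in\mathbb{R}$ be determined by $$\frac1q-\frac bn=\frac1p-\frac{1+a}{n}.$$ Then there exists a constant $C=C(n,p,q,a,b,\Omega)>0$ such that every $u\in C_c^\infty(\Omega)$ with $u\in X^{1,p,a}(\mathbb{R}^n)$ satisfies $u\in X^{0,q,b}(\mathbb{R}^n)$ and $$\big\||x|^{-b}u\big\|_{X^q(\mathbb{R}^n)}\le C\,\big\||x|^{-a}Du\big\|_{X^p(\mathbb{R}^n)}.$$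
   Context: Exponents are parametrized by their reciprocals: $1/p$ is a real number, $1/p=0$ means $p=\infty$, and $1/p<0$ means $p$ is a negative real number. Unified scale $X^p(\Omega)$ for an open set $\Omega\subset\mathbb{R}^n$ (including $\Omega=\mathbb{R}^n$): - if $0<p<\infty$, $X^p(\Omega)=L^p(\Omega)$ with $\|u\|_{X^p(\Omega)}=\left(\int_\Omega|u|^p\,dx\right)^{1/p}$; - if $p=\infty$, $X^\infty(\Omega)=L^\infty(\Omega)$ with the essential supremum norm; - if $-\infty<p<0$, put $(p)_1=-\left[\frac np+1\right]$ (with $[\cdot]$ the integer part, i.e. floor) and $(p)_2=-\frac np-(p)_1\in(0,1]$; then $X^p(\Omega)=C^{(p)_1,(p)_2}(\Omega)$ with $$\|u\|_{X^p(\Omega)}=\max_{|\alpha|\le (p)_1}\sup_{x\in\Omega}|D^\alpha u(x)|+\sum_{|\alpha|=(p)_1}\sup_{x,y\in\Omega,\ x\neq y}\frac{|D^\alpha u(x)-D^\alpha u(y)|}{|x-y|^{(p)_2}}.$$ (In particular, for $-\frac1n<\frac1p<0$ one has $(p)_1=0$ and $(p)_2=-\frac np\in(0,1)$.) Weighted spaces: for $k\in\mathbb{N}_0$ and $a\in\mathbb{R}$, $$X^{k,p,a}(\Omega)=\{u:\ |x|^{-a}D^\alpha u\in X^p(\Omega)\ \text{for all multi-indices } |\alpha|\le k\}$$ (derivatives in the weak sense). $Du=\nabla u$ is the gradient. Functions in $C_c^\infty(\Omega)$, and their products (and those of their derivatives) with powers of $|x|$, are extended by zero to $\mathbb{R}^n$.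 *)

theory Defs
  imports "HOL-Analysis.Analysis" "HOL-Probability.Essential_Supremum"
begin

definition partial_deriv :: "'n::finite \<Rightarrow> (real^'n \<Rightarrow> 'b::real_normed_vector) \<Rightarrow> real^'n \<Rightarrow> 'b" where
  "partial_deriv i f x = frechet_derivative f (at x) (axis i 1)"

definition grad :: "(real^'n::finite \<Rightarrow> real) \<Rightarrow> real^'n \<Rightarrow> real^'n" where
  "grad f x = (\<chi> i. partial_deriv i f x)"

(* Intended for open sets only. *)
primrec Ck_on :: "nat \<Rightarrow> (real^'n::finite) set \<Rightarrow> (real^'n \<Rightarrow> 'b::real_normed_vector) \<Rightarrow> bool" where
  "Ck_on 0 S f \<longleftrightarrow> continuous_on S f"
| "Ck_on (Suc k) S f \<longleftrightarrow>
     (\<forall>x\<in>S. f differentiable (at x)) \<and> (\<forall>i. Ck_on k S (partial_deriv i f))"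

definition mi_order :: "('n::finite \<Rightarrow> nat) \<Rightarrow> nat" where
  "mi_order \<alpha> = sum \<alpha> UNIV"

(* The index type carries no order, so some list in which each direction i occurs exactly
   \<alpha> i times is chosen; by the symmetry of mixed derivatives the choice does not matter for
   functions of class C^k with k = mi_order \<alpha>, the only ones to which this is applied. *)
definition mi_deriv :: "('n::finite \<Rightarrow> nat) \<Rightarrow> (real^'n \<Rightarrow> 'b::real_normed_vector) \<Rightarrow> real^'n \<Rightarrow> 'b" where
  "mi_deriv \<alpha> f = foldr partial_deriv (SOME is. \<forall>i. count_list is i = \<alpha> i) f"

(* Elements are total functions: extension by zero to the whole space is built in. *)
definition Cc_infinity :: "(real^'n::finite) set \<Rightarrow> (real^'n \<Rightarrow> real) set" where
  "Cc_infinity \<Omega> = {u. (\<forall>k. Ck_on k UNIV u) \<and>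
     compact (closure {x. u x \<noteq> 0}) \<and> closure {x. u x \<noteq> 0} \<subseteq> \<Omega>}"

definition locally_integrable_on :: "(real^'n::finite \<Rightarrow> real) \<Rightarrow> (real^'n) set \<Rightarrow> bool" where
  "locally_integrable_on u \<Omega> \<longleftrightarrow> (\<forall>K. compact K \<and> K \<subseteq> \<Omega> \<longrightarrow> u absolutely_integrable_on K)"

definition weak_deriv ::
  "(real^'n::finite) set \<Rightarrow> ('n \<Rightarrow> nat) \<Rightarrow> (real^'n \<Rightarrow> real) \<Rightarrow> (real^'n \<Rightarrow> real) \<Rightarrow> bool" where
  "weak_deriv \<Omega> \<alpha> u v \<longleftrightarrow>
     locally_integrable_on u \<Omega> \<and> locally_integrable_on v \<Omega> \<and>
     (\<forall>\<phi>\<in>Cc_infinity \<Omega>.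
        (LINT x|lebesgue_on \<Omega>. u x * mi_deriv \<alpha> \<phi> x) =
        (-1) ^ mi_order \<alpha> * (LINT x|lebesgue_on \<Omega>. v x * \<phi> x))"

(* From here on the exponent p is represented by its reciprocal r = 1/p, with r = 0 for
   p = \<infinity> and r < 0 for negative p, and n = CARD('n). Norms take values in ennreal, with
   value top where the norm is infinite. *)

(* (p)_1; the floor is nonpositive for r < 0. *)
definition hoelder_order :: "nat \<Rightarrow> real \<Rightarrow> nat" where
  "hoelder_order n r = nat (- \<lfloor>real n * r + 1\<rfloor>)"

(* (p)_2 *)
definition hoelder_exponent :: "nat \<Rightarrow> real \<Rightarrow> real" where
  "hoelder_exponent n r = - (real n * r) - real (hoelder_order n r)"

definition Lp_norm :: "real \<Rightarrow> (real^'n::finite) set \<Rightarrow> (real^'n \<Rightarrow> 'b::real_normed_vector) \<Rightarrow> ennreal" where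
  "Lp_norm r \<Omega> f =
     (let I = (\<integral>\<^sup>+x. ennreal (norm (f x) powr (1 / r)) \<partial>lebesgue_on \<Omega>)
      in if I = top then top else ennreal (enn2real I powr r))"

definition Linf_norm :: "(real^'n::finite) set \<Rightarrow> (real^'n \<Rightarrow> 'b::real_normed_vector) \<Rightarrow> ennreal" where
  "Linf_norm \<Omega> f = esssup (lebesgue_on \<Omega>) (\<lambda>x. ennreal (norm (f x)))"

definition hoelder_norm ::
  "nat \<Rightarrow> real \<Rightarrow> (real^'n::finite) set \<Rightarrow> (real^'n \<Rightarrow> 'b::real_normed_vector) \<Rightarrow> ennreal" where
  "hoelder_norm k \<theta> \<Omega> f =
     (MAX \<alpha>\<in>{\<alpha>. mi_order \<alpha> \<le> k}. SUP x\<in>\<Omega>. ennreal (norm (mi_deriv \<alpha> f x))) +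
     (\<Sum>\<alpha> | mi_order \<alpha> = k. SUP (x, y)\<in>{(x, y). x \<in> \<Omega> \<and> y \<in> \<Omega> \<and> x \<noteq> y}.
        ennreal (norm (mi_deriv \<alpha> f x - mi_deriv \<alpha> f y) / norm (x - y) powr \<theta>))"

definition X_norm :: "real \<Rightarrow> (real^'n::finite) set \<Rightarrow> (real^'n \<Rightarrow> 'b::real_normed_vector) \<Rightarrow> ennreal" where
  "X_norm r \<Omega> f =
     (if 0 < r then Lp_norm r \<Omega> f
      else if r = 0 then Linf_norm \<Omega> f
      else hoelder_norm (hoelder_order CARD('n) r) (hoelder_exponent CARD('n) r) \<Omega> f)"

definition X_space :: "real \<Rightarrow> (real^'n::finite) set \<Rightarrow> (real^'n \<Rightarrow> 'b::real_normed_vector) set" where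
  "X_space r \<Omega> =
     {f. (if 0 \<le> r then f \<in> borel_measurable (lebesgue_on \<Omega>)
          else Ck_on (hoelder_order CARD('n) r) \<Omega> f) \<and> X_norm r \<Omega> f < top}"

(* D^\<alpha> u is a weak derivative, hence determined only up to null sets; so membership of
   |x|^{-a} D^\<alpha> u in the scale means that it has a representative g there. This also makes
   the value of the weight at the origin (where powr yields 0) irrelevant. *)
definition WX_space :: "nat \<Rightarrow> real \<Rightarrow> real \<Rightarrow> (real^'n::finite) set \<Rightarrow> (real^'n \<Rightarrow> real) set" where
  "WX_space k r a \<Omega> =
     {u. \<forall>\<alpha>. mi_order \<alpha> \<le> k \<longrightarrow>
        (\<exists>v. weak_deriv \<Omega> \<alpha> u v \<and>
          (\<exists>g\<in>X_space r \<Omega>. AE x in lebesgue_on \<Omega>. g x = norm x powr (-a) * v x))}"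

end

theory Submission
  imports Defs
begin

text \<open>
  Since \<open>\<Omega>\<close> is bounded and stays away from the origin, it lies in an annulus \<open>d \<le> |x| \<le> R\<close>, where every
  power of \<open>|x|\<close> is bounded and Lipschitz. Up to a constant that depends on \<open>\<Omega>\<close>, the weights
  therefore disappear, and what has to be bounded is the norm of \<open>u\<close> by the \<open>L\<^sup>p\<close> norm of \<open>Du\<close>, for
  functions supported in a bounded set. The two ranges of \<open>1/p\<close> are the two classical Sobolev
  embeddings.

  For \<open>1/n < 1/p \<le> 1\<close> this is the inequality of Gagliardo, Nirenberg and Sobolev
  (\<open>Gagliardo_Nirenberg_Sobolev\<close>). Applying the fundamental theorem of calculus to \<open>|u|\<^sup>\<gamma>\<close> along a line
  parallel to the \<open>i\<close>-th axis bounds \<open>|u(x)|\<^sup>\<gamma>\<close> by the integral of \<open>\<gamma> |u|\<^bsup>\<gamma>-1\<^esup> |Du|\<close> over this line. Multiplying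
  the \<open>n\<close> bounds and integrating leads to an integral of a product of line integrals, which
  \<open>grid_lines_inequality\<close> bounds by a power of the full integral; its proof is an induction on the
  number of coordinates with Hoelder's inequality for several functions as induction step. Hoelder's
  inequality once more splits \<open>|u|\<^bsup>\<gamma>-1\<^esup> |Du|\<close>, and the right choice of \<open>\<gamma>\<close> lets the powers of \<open>|u|\<close> be
  cancelled. This settles \<open>1/q = 1/p - 1/n\<close>, and a larger \<open>1/q\<close> is reached by Hoelder's inequality on
  the bounded support.

  For \<open>0 < 1/p < 1/n\<close> this is Morrey's inequality (\<open>Morrey_inequality\<close>): both \<open>u(x)\<close> and \<open>u(y)\<close> are
  compared with the mean of \<open>u\<close> over the ball with diameter the segment from \<open>x\<close> to \<open>y\<close>. Comparing
  with a point outside \<open>\<Omega>\<close>, where \<open>u\<close> vanishes, it also bounds the supremum of \<open>u\<close>. Together these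
  give the Hoelder norms for all smaller exponents, and the \<open>L\<^sup>q\<close> norms for all \<open>q\<close> up to \<open>\<infinity>\<close>.
\<close>

section \<open>Real powers of extended nonnegative numbers\<close>

text \<open>
  The convention \<open>x\<^sup>0 = 1\<close> holds for \<open>x = 0\<close> and \<open>x = \<infinity>\<close> as well, in contrast to \<open>powr\<close>. It makes the laws
  of exponents hold for all nonnegative exponents, and factors with exponent 0 drop out of products,
  as they must in the boundary cases \<open>p = 1\<close> and \<open>(card I - 1) * p = 1\<close> below.
\<close>

definition epow :: "ennreal \<Rightarrow> real \<Rightarrow> ennreal" where
  "epow x r = (if r = 0 then 1 else if x = top then top else ennreal (enn2real x powr r))"

lemma epow_0 [simp]: "epow x 0 = 1"
  by (simp add: epow_def)

lemma epow_zero [simp]: "r \<noteq> 0 \<Longrightarrow> epow 0 r = 0"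
  by (simp add: epow_def)

lemma epow_top [simp]: "r \<noteq> 0 \<Longrightarrow> epow top r = top"
  by (simp add: epow_def)

lemma epow_1 [simp]: "epow x 1 = x"
  by (cases x) (auto simp: epow_def)

lemma epow_base_1 [simp]: "epow 1 r = 1"
  by (simp add: epow_def)

lemma epow_ennreal: "0 \<le> x \<Longrightarrow> r \<noteq> 0 \<Longrightarrow> epow (ennreal x) r = ennreal (x powr r)"
  by (simp add: epow_def)

lemma epow_ennreal_pos: "0 < x \<Longrightarrow> epow (ennreal x) r = ennreal (x powr r)"
  by (cases "r = 0") (simp_all add: epow_def)

lemma epow_mono: "0 \<le> r \<Longrightarrow> x \<le> y \<Longrightarrow> epow x r \<le> epow y r"
  by (cases x; cases y) (auto simp: epow_def intro!: powr_mono2 ennreal_leI simp: top_unique)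

lemma epow_eq_0_iff: "0 < r \<Longrightarrow> epow x r = 0 \<longleftrightarrow> x = 0"
  by (cases x) (auto simp: epow_def)

lemma epow_eq_top_iff: "0 < r \<Longrightarrow> epow x r = top \<longleftrightarrow> x = top"
  by (cases x) (auto simp: epow_def)

lemma epow_add:
  assumes "0 \<le> r" "0 \<le> s"
  shows "epow x (r + s) = epow x r * epow x s"
proof (cases x)
  case (real y)
  then show ?thesis using assms
    by (cases "r = 0"; cases "s = 0") (auto simp: epow_ennreal powr_add ennreal_mult)
next
  case top
  then show ?thesis using assms
    by (cases "r = 0"; cases "s = 0") (auto simp: ennreal_top_mult)
qed

lemma epow_mult:
  assumes "0 \<le> r"
  shows "epow (x * y) r = epow x r * epow y r"
proof (cases "r = 0")
  case False
  show ?thesis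
  proof (cases "x = 0 \<or> y = 0")
    case True then show ?thesis using False by auto
  next
    case nz: False
    show ?thesis using assms nz False
      by (cases x; cases y)
         (auto simp: epow_ennreal powr_mult ennreal_mult[symmetric] ennreal_top_mult ennreal_mult_top)
  qed
qed auto

lemma epow_epow: "0 \<le> r \<Longrightarrow> 0 \<le> s \<Longrightarrow> epow (epow x r) s = epow x (r * s)"
  by (cases x; cases "r = 0"; cases "s = 0") (auto simp: epow_ennreal powr_powr)

lemma measurable_epow [measurable (raw)]:
  assumes [measurable]: "f \<in> borel_measurable M"
  shows "(\<lambda>x. epow (f x) r) \<in> borel_measurable M"
  unfolding epow_def by measurable

section \<open>Hoelder's inequality for several functions\<close>

text \<open>Convexity of the exponential function, applied to the logarithms of the \<open>y j\<close>.\<close>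
lemma weighted_AM_GM_ennreal:
  fixes w :: "'i \<Rightarrow> real" and y :: "'i \<Rightarrow> ennreal"
  assumes A: "finite A" and w: "\<And>j. j \<in> A \<Longrightarrow> 0 < w j" and w1: "sum w A = 1"
  shows "(\<Prod>j\<in>A. epow (y j) (w j)) \<le> (\<Sum>j\<in>A. ennreal (w j) * y j)"
proof (cases "\<exists>j\<in>A. y j = 0 \<or> y j = top")
  case True
  then obtain j where j: "j \<in> A" "y j = 0 \<or> y j = top" by auto
  show ?thesis
  proof (cases "y j = 0")
    case True
    then have "(\<Prod>j\<in>A. epow (y j) (w j)) = 0"
      using j(1) w[OF j(1)] by (intro prod_zero[OF A] bexI[of _ j]) auto
    then show ?thesis by (simp only: zero_le)
  next
    case False
    then have "ennreal (w j) * y j = top" using j w[OF j(1)] by (auto simp: ennreal_mult_top)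
    then have "(\<Sum>j\<in>A. ennreal (w j) * y j) = top"
      using A j(1) by (simp add: sum.remove[of A j])
    then show ?thesis by simp
  qed
next
  case False
  define z where "z j = enn2real (y j)" for j
  have y: "y j = ennreal (z j)" "z j > 0" if "j \<in> A" for j
    using False that by (cases "y j"; force simp: z_def)+
  have "(\<Prod>j\<in>A. epow (y j) (w j)) = (\<Prod>j\<in>A. ennreal (z j powr w j))"
    using y by (intro prod.cong) (auto simp: epow_ennreal_pos)
  also have "\<dots> = ennreal (\<Prod>j\<in>A. z j powr w j)"
    by (simp add: prod_ennreal)
  also have "(\<Prod>j\<in>A. z j powr w j) = (\<Prod>j\<in>A. exp (w j * ln (z j)))"
    using y(2) by (intro prod.cong refl) (simp add: powr_def less_imp_neq[symmetric])
  also have "\<dots> = exp (\<Sum>j\<in>A. w j *\<^sub>R ln (z j))"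
    using A by (simp add: exp_sum)
  also have "ennreal \<dots> \<le> ennreal (\<Sum>j\<in>A. w j * exp (ln (z j)))"
    using A w w1 by (intro ennreal_leI convex_on_sum[OF _ _ exp_convex])
      (auto intro: less_imp_le)
  also have "(\<Sum>j\<in>A. w j * exp (ln (z j))) = (\<Sum>j\<in>A. w j * z j)"
    using y(2) by (intro sum.cong) auto
  also have "ennreal (\<Sum>j\<in>A. w j * z j) = (\<Sum>j\<in>A. ennreal (w j * z j))"
    using w y(2) by (intro sum_ennreal[symmetric]) (auto simp: less_imp_le)
  also have "\<dots> = (\<Sum>j\<in>A. ennreal (w j) * y j)"
    using w y by (intro sum.cong refl) (auto simp: ennreal_mult less_imp_le)
  finally show ?thesis .
qed

text \<open>
  Hoelder's inequality: divide each function by its integral, apply the weighted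
  arithmetic-geometric mean inequality pointwise, and integrate. The division needs integrals that
  are neither 0 nor infinite; the other cases are degenerate once the indices of weight 0 are dropped.
\<close>
lemma nn_integral_prod_epow_le:
  fixes w :: "'i \<Rightarrow> real" and f :: "'i \<Rightarrow> 'a \<Rightarrow> ennreal"
  assumes fin: "finite A" and meas: "\<And>j. j \<in> A \<Longrightarrow> f j \<in> borel_measurable M"
    and w: "\<And>j. j \<in> A \<Longrightarrow> 0 \<le> w j" and w1: "sum w A = 1"
  shows "(\<integral>\<^sup>+x. (\<Prod>j\<in>A. epow (f j x) (w j)) \<partial>M) \<le> (\<Prod>j\<in>A. epow (\<integral>\<^sup>+x. f j x \<partial>M) (w j))"
proof -
  define B where "B = {j\<in>A. 0 < w j}"
  have B: "finite B" "B \<subseteq> A" using fin by (auto simp: B_def)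
  have wB: "sum w B = 1" "\<And>j. j \<in> B \<Longrightarrow> 0 < w j"
  proof -
    have "sum w B = sum w A"
      using fin w by (intro sum.mono_neutral_left) (auto simp: B_def less_le)
    then show "sum w B = 1" using w1 by simp
  qed (simp add: B_def)
  have red: "(\<Prod>j\<in>A. epow (g j) (w j)) = (\<Prod>j\<in>B. epow (g j) (w j))" for g :: "'i \<Rightarrow> ennreal"
    using fin w by (intro prod.mono_neutral_right) (auto simp: B_def less_le)
  define c where "c j = (\<integral>\<^sup>+x. f j x \<partial>M)" for j
  note [measurable] = meas
  have mB [measurable]: "f j \<in> borel_measurable M" if "j \<in> B" for j
    using that B meas by auto
  have "(\<integral>\<^sup>+x. (\<Prod>j\<in>B. epow (f j x) (w j)) \<partial>M) \<le> (\<Prod>j\<in>B. epow (c j) (w j))"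
  proof (cases "\<exists>j\<in>B. c j = 0")
    case True
    then obtain j where j: "j \<in> B" "c j = 0" by auto
    then have "AE x in M. f j x = 0"
      using mB[OF j(1)] by (simp add: c_def nn_integral_0_iff_AE)
    then have "AE x in M. (\<Prod>j\<in>B. epow (f j x) (w j)) = 0"
    proof eventually_elim
      case (elim x)
      then show ?case using elim j wB(2)[OF j(1)] by (intro prod_zero[OF B(1)] bexI[of _ j]) auto
    qed
    then have "(\<integral>\<^sup>+x. (\<Prod>j\<in>B. epow (f j x) (w j)) \<partial>M) = (\<integral>\<^sup>+x. 0 \<partial>M)"
      by (rule nn_integral_cong_AE)
    then show ?thesis by (simp only: nn_integral_const mult_zero_left zero_le)
  next
    case nz: False
    show ?thesis
    proof (cases "\<exists>j\<in>B. c j = top")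
      case True
      then obtain j where j: "j \<in> B" "c j = top" by auto
      have "(\<Prod>k\<in>B - {j}. epow (c k) (w k)) \<noteq> 0"
        using nz B wB by (auto simp: epow_eq_0_iff)
      then have "(\<Prod>j\<in>B. epow (c j) (w j)) = top"
        using j B wB(2)[OF j(1)] by (simp add: prod.remove[of B j] ennreal_top_mult)
      then show ?thesis by simp
    next
      case nt: False
      have "(\<integral>\<^sup>+x. (\<Prod>j\<in>B. epow (f j x) (w j)) \<partial>M)
          \<le> (\<integral>\<^sup>+x. (\<Prod>j\<in>B. epow (c j) (w j)) * (\<Sum>j\<in>B. ennreal (w j) * (f j x / c j)) \<partial>M)"
      proof (rule nn_integral_mono)
        fix x
        have "(\<Prod>j\<in>B. epow (f j x) (w j)) = (\<Prod>j\<in>B. epow (c j) (w j) * epow (f j x / c j) (w j))"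
        proof (intro prod.cong refl)
          fix j assume j: "j \<in> B"
          have "c j * (f j x / c j) = f j x"
            using nz nt j by (simp add: ennreal_times_divide mult.commute[of "c j"] ennreal_mult_divide_eq)
          then show "epow (f j x) (w j) = epow (c j) (w j) * epow (f j x / c j) (w j)"
            using wB(2)[OF j] by (simp add: epow_mult[symmetric])
        qed
        also have "\<dots> = (\<Prod>j\<in>B. epow (c j) (w j)) * (\<Prod>j\<in>B. epow (f j x / c j) (w j))"
          by (simp add: prod.distrib)
        also have "\<dots> \<le> (\<Prod>j\<in>B. epow (c j) (w j)) * (\<Sum>j\<in>B. ennreal (w j) * (f j x / c j))"
          using B wB by (intro mult_left_mono weighted_AM_GM_ennreal) auto
        finally show "(\<Prod>j\<in>B. epow (f j x) (w j))
          \<le> (\<Prod>j\<in>B. epow (c j) (w j)) * (\<Sum>j\<in>B. ennreal (w j) * (f j x / c j))" .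
      qed
      also have "\<dots> = (\<Prod>j\<in>B. epow (c j) (w j)) * (\<Sum>j\<in>B. ennreal (w j) * (c j / c j))"
        by (simp add: nn_integral_cmult nn_integral_sum nn_integral_divide c_def)
      also have "(\<Sum>j\<in>B. ennreal (w j) * (c j / c j)) = (\<Sum>j\<in>B. ennreal (w j))"
        using nz nt by (intro sum.cong refl) (simp add: ennreal_divide_self less_top[symmetric])
      also have "\<dots> = 1"
        using wB by (simp add: sum_ennreal less_imp_le)
      finally show ?thesis by simp
    qed
  qed
  then show ?thesis by (simp add: red c_def)
qed

lemma nn_integral_Holder:
  assumes f [measurable]: "f \<in> borel_measurable M" "g \<in> borel_measurable M"
    and r: "0 \<le> r" "r \<le> 1"
  shows "(\<integral>\<^sup>+x. epow (f x) (1 - r) * epow (g x) r \<partial>M)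
      \<le> epow (\<integral>\<^sup>+x. f x \<partial>M) (1 - r) * epow (\<integral>\<^sup>+x. g x \<partial>M) r"
proof -
  have "(\<integral>\<^sup>+x. (\<Prod>j\<in>{False,True}. epow ((if j then g else f) x) (if j then r else 1 - r)) \<partial>M)
     \<le> (\<Prod>j\<in>{False,True}. epow (\<integral>\<^sup>+x. (if j then g else f) x \<partial>M) (if j then r else 1 - r))"
    using r by (intro nn_integral_prod_epow_le) auto
  then show ?thesis by simp
qed

text \<open>
  This agrees with the norm of the space \<open>X\<close> for a positive reciprocal exponent \<open>r\<close>. The integrands
  are \<open>ennreal\<close>-valued so that the same inequalities cover infinite norms.
\<close>
definition Lp_seminorm :: "'a measure \<Rightarrow> real \<Rightarrow> ('a \<Rightarrow> ennreal) \<Rightarrow> ennreal" where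
  "Lp_seminorm M r f = epow (\<integral>\<^sup>+x. epow (f x) (1 / r) \<partial>M) r"

text \<open>Hoelder's inequality for \<open>f\<close> and the indicator function of \<open>S\<close>.\<close>
lemma Lp_seminorm_mono_exponent:
  fixes f :: "'a \<Rightarrow> ennreal"
  assumes [measurable]: "f \<in> borel_measurable M" "S \<in> sets M" and S: "\<And>x. x \<in> space M \<Longrightarrow> x \<notin> S \<Longrightarrow> f x = 0"
    and q: "0 < q" "q \<le> r"
  shows "Lp_seminorm M r f \<le> epow (emeasure M S) (r - q) * Lp_seminorm M q f"
proof -
  have "(\<integral>\<^sup>+x. epow (f x) (1 / r) \<partial>M) = (\<integral>\<^sup>+x. epow (indicator S x) (1 - q / r) * epow (epow (f x) (1 / q)) (q / r) \<partial>M)"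
  proof (intro nn_integral_cong)
    fix x assume "x \<in> space M"
    then show "epow (f x) (1 / r) = epow (indicator S x) (1 - q / r) * epow (epow (f x) (1 / q)) (q / r)"
      using q S[of x] by (cases "x \<in> S") (auto simp: epow_epow)
  qed
  also have "\<dots> \<le> epow (emeasure M S) (1 - q / r) * epow (\<integral>\<^sup>+x. epow (f x) (1 / q) \<partial>M) (q / r)"
    using nn_integral_Holder[of "indicator S" M "\<lambda>x. epow (f x) (1 / q)" "q / r"] q by simp
  finally have "epow (\<integral>\<^sup>+x. epow (f x) (1 / r) \<partial>M) r
     \<le> epow (epow (emeasure M S) (1 - q / r) * epow (\<integral>\<^sup>+x. epow (f x) (1 / q) \<partial>M) (q / r)) r"
    using q by (intro epow_mono) auto
  also have "\<dots> = epow (emeasure M S) (r - q) * epow (\<integral>\<^sup>+x. epow (f x) (1 / q) \<partial>M) q"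
    using q by (simp add: epow_mult epow_epow left_diff_distrib)
  finally show ?thesis unfolding Lp_seminorm_def .
qed

lemma Lp_seminorm_cmult_mono:
  assumes [measurable]: "g \<in> borel_measurable M" and le: "\<And>x. x \<in> space M \<Longrightarrow> f x \<le> K * g x" and r: "0 < r"
  shows "Lp_seminorm M r f \<le> K * Lp_seminorm M r g"
proof -
  have "(\<integral>\<^sup>+x. epow (f x) (1 / r) \<partial>M) \<le> (\<integral>\<^sup>+x. epow K (1 / r) * epow (g x) (1 / r) \<partial>M)"
    using le r by (intro nn_integral_mono) (auto simp: epow_mult[symmetric] intro!: epow_mono)
  also have "\<dots> = epow K (1 / r) * (\<integral>\<^sup>+x. epow (g x) (1 / r) \<partial>M)"
    by (intro nn_integral_cmult) measurable
  finally have "Lp_seminorm M r f \<le> epow (epow K (1 / r) * (\<integral>\<^sup>+x. epow (g x) (1 / r) \<partial>M)) r"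
    unfolding Lp_seminorm_def using r by (intro epow_mono) auto
  also have "\<dots> = K * Lp_seminorm M r g"
    using r by (simp add: epow_mult epow_epow Lp_seminorm_def)
  finally show ?thesis .
qed

lemma Lp_seminorm_indicator:
  assumes "S \<in> sets M" "0 < r"
  shows "Lp_seminorm M r (indicator S) = epow (emeasure M S) r"
proof -
  have "(\<integral>\<^sup>+x. epow (indicator S x) (1 / r) \<partial>M) = (\<integral>\<^sup>+x. indicator S x \<partial>M)"
    using assms by (intro nn_integral_cong) (auto split: split_indicator)
  then show ?thesis using assms by (simp add: Lp_seminorm_def)
qed

section \<open>The grid-lines inequality\<close>

text \<open>
  With \<open>p = 1 / (card I - 1)\<close> the first factor is 1, and what remains is the product over all
  directions of powers of the integrals of \<open>f\<close> along the axis-parallel lines through \<open>x\<close>. The first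
  factor makes the total degree in \<open>f\<close> equal to \<open>1 + p\<close> for every \<open>I\<close>, which is what lets the
  inequality below be proved by induction on \<open>I\<close> with \<open>p\<close> fixed.
\<close>
definition grid_integrand :: "'i set \<Rightarrow> real \<Rightarrow> (('i \<Rightarrow> real) \<Rightarrow> ennreal) \<Rightarrow> ('i \<Rightarrow> real) \<Rightarrow> ennreal" where
  "grid_integrand I p f x =
     epow (f x) (1 - (real (card I) - 1) * p) * (\<Prod>i\<in>I. epow (\<integral>\<^sup>+t. f (x(i := t)) \<partial>lborel) p)"

text \<open>
  In the induction step, integrate first over the new coordinate \<open>i\<close>. The line integral of \<open>f\<close> in
  direction \<open>i\<close> does not depend on that coordinate and comes out of the integral. Hoelder's inequality
  replaces each of the other factors by its integral, and after exchanging the order of integration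
  the result is the integrand for the index set \<open>I\<close> and the function \<open>g\<close> obtained from \<open>f\<close> by
  integrating out the coordinate \<open>i\<close>.
\<close>
lemma grid_lines_inequality:
  fixes f :: "('i \<Rightarrow> real) \<Rightarrow> ennreal"
  assumes "finite I" and "0 \<le> p" and "(real (card I) - 1) * p \<le> 1"
    and "f \<in> borel_measurable (Pi\<^sub>M I (\<lambda>_. lborel))"
  shows "(\<integral>\<^sup>+x. grid_integrand I p f x \<partial>Pi\<^sub>M I (\<lambda>_. lborel))
     \<le> epow (\<integral>\<^sup>+x. f x \<partial>Pi\<^sub>M I (\<lambda>_. lborel)) (1 + p)"
  using assms
proof (induction I arbitrary: f)
  case empty
  then show ?case 
    by (simp add: grid_integrand_def PiM_empty nn_integral_count_space_finite)
next
  case (insert i I)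
  interpret P: product_sigma_finite "\<lambda>_::'i. lborel :: real measure" ..
  note p = \<open>0 \<le> p\<close>
  have fm [measurable]: "f \<in> borel_measurable (Pi\<^sub>M (insert i I) (\<lambda>_. lborel))" by fact
  define g where "g x = (\<integral>\<^sup>+t. f (x(i := t)) \<partial>lborel)" for x
  have gm [measurable]: "g \<in> borel_measurable (Pi\<^sub>M I (\<lambda>_. lborel))"
    unfolding g_def by measurable
  have card: "real (card (insert i I)) - 1 = real (card I)"
    using insert by simp
  have cp: "real (card I) * p \<le> 1" using insert.prems(2) card by simp
  then have cp': "(real (card I) - 1) * p \<le> 1" using p by (simp add: algebra_simps)
  have hm [measurable]: "(\<lambda>z. \<integral>\<^sup>+t. f (z(j := t)) \<partial>lborel) \<in> borel_measurable (Pi\<^sub>M (insert i I) (\<lambda>_. lborel))"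
    if j: "j \<in> insert i I" for j
  proof -
    have "(\<lambda>z. (fst z)(j := snd z)) \<in> Pi\<^sub>M (insert i I) (\<lambda>_. lborel :: real measure) \<Otimes>\<^sub>M lborel \<rightarrow>\<^sub>M Pi\<^sub>M (insert i I) (\<lambda>_. lborel)"
      using j by (intro measurable_fun_upd[where J="insert i I"]) auto
    from measurable_compose[OF this fm] show ?thesis
      by (intro lborel.borel_measurable_nn_integral) (simp add: split_beta')
  qed
  have gim: "(grid_integrand (insert i I) p f) \<in> borel_measurable (Pi\<^sub>M (insert i I) (\<lambda>_. lborel))"
    unfolding grid_integrand_def by measurable
  have "(\<integral>\<^sup>+x. grid_integrand (insert i I) p f x \<partial>Pi\<^sub>M (insert i I) (\<lambda>_. lborel))
     = (\<integral>\<^sup>+x. \<integral>\<^sup>+y. grid_integrand (insert i I) p f (x(i := y)) \<partial>lborel \<partial>Pi\<^sub>M I (\<lambda>_. lborel))"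
    using insert gim by (intro P.product_nn_integral_insert)
  also have "\<dots> \<le> (\<integral>\<^sup>+x. grid_integrand I p g x \<partial>Pi\<^sub>M I (\<lambda>_. lborel))"
  proof (rule nn_integral_mono)
    fix x assume x: "x \<in> space (Pi\<^sub>M I (\<lambda>_. lborel :: real measure))"
    (* The factors to which Hoelder's inequality is applied: f itself, with the exponent that
       remains for it, and the line integrals in the directions j in I. *)
    define F where "F j y = (if j = i then f (x(i := y)) else \<integral>\<^sup>+t. f ((x(i := y))(j := t)) \<partial>lborel)" for j y
    define w where "w j = (if j = i then 1 - real (card I) * p else p)" for j
    have up [measurable]: "(\<lambda>y. x(i := y)) \<in> lborel \<rightarrow>\<^sub>M Pi\<^sub>M (insert i I) (\<lambda>_. lborel :: real measure)"
      using x by (intro measurable_fun_upd[where J=I]) auto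
    have Fm [measurable]: "F j \<in> borel_measurable lborel" if j: "j \<in> insert i I" for j
    proof (cases "j = i")
      case True
      then show ?thesis using measurable_compose[OF up fm] by (simp add: F_def[abs_def])
    next
      case False
      then show ?thesis using measurable_compose[OF up hm[OF j]] by (simp add: F_def[abs_def])
    qed
    have 1: "grid_integrand (insert i I) p f (x(i := y)) = epow (g x) p * (\<Prod>j\<in>insert i I. epow (F j y) (w j))" for y
    proof -
      have "(\<Prod>j\<in>I. epow (\<integral>\<^sup>+t. f ((x(i := y))(j := t)) \<partial>lborel) p) = (\<Prod>j\<in>I. epow (F j y) (w j))"
        using insert.hyps by (intro prod.cong) (auto simp: F_def w_def)
      then show ?thesis using insert.hyps
        unfolding grid_integrand_def card
        by (simp add: g_def F_def w_def mult_ac)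
    qed
    have int: "(\<integral>\<^sup>+y. F j y \<partial>lborel) = (\<integral>\<^sup>+t. g (x(j := t)) \<partial>lborel)" if j: "j \<in> I" for j
    proof -
      have ij: "i \<noteq> j" using insert.hyps j by auto
      have "(\<lambda>z. (x(i := snd z))(j := fst z)) \<in> lborel \<Otimes>\<^sub>M lborel \<rightarrow>\<^sub>M Pi\<^sub>M (insert i I) (\<lambda>_. lborel :: real measure)"
        using j by (intro measurable_fun_upd[where J="insert i I"] measurable_compose[OF _ up]) auto
      from measurable_compose[OF this fm]
      have "(\<lambda>z. f ((x(i := snd z))(j := fst z))) \<in> borel_measurable (lborel \<Otimes>\<^sub>M lborel)" .
      from lborel_pair.Fubini[OF this] ij
      show ?thesis by (simp add: F_def g_def fun_upd_twist)
    qed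
    have "(\<integral>\<^sup>+y. grid_integrand (insert i I) p f (x(i := y)) \<partial>lborel)
      = epow (g x) p * (\<integral>\<^sup>+y. (\<Prod>j\<in>insert i I. epow (F j y) (w j)) \<partial>lborel)"
      unfolding 1 by (intro nn_integral_cmult) measurable
    also have "\<dots> \<le> epow (g x) p * (\<Prod>j\<in>insert i I. epow (\<integral>\<^sup>+y. F j y \<partial>lborel) (w j))"
    proof (intro mult_left_mono nn_integral_prod_epow_le)
      have "sum w I = real (card I) * p"
        using insert.hyps by (subst sum.cong[of I I w "\<lambda>_. p"]) (auto simp: w_def)
      then show "sum w (insert i I) = 1" using insert.hyps by (simp add: w_def)
    qed (use insert.hyps cp p Fm in \<open>auto simp: w_def\<close>)
    also have "(\<Prod>j\<in>insert i I. epow (\<integral>\<^sup>+y. F j y \<partial>lborel) (w j))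
      = epow (g x) (1 - real (card I) * p) * (\<Prod>j\<in>I. epow (\<integral>\<^sup>+t. g (x(j := t)) \<partial>lborel) p)"
    proof -
      have "(\<Prod>j\<in>I. epow (\<integral>\<^sup>+y. F j y \<partial>lborel) (w j)) = (\<Prod>j\<in>I. epow (\<integral>\<^sup>+t. g (x(j := t)) \<partial>lborel) p)"
        using insert.hyps int by (intro prod.cong) (auto simp: w_def)
      then show ?thesis using insert.hyps by (simp add: w_def F_def g_def)
    qed
    also have "epow (g x) p * \<dots> = grid_integrand I p g x"
    proof -
      have "epow (g x) (1 - (real (card I) - 1) * p) = epow (g x) p * epow (g x) (1 - real (card I) * p)"
        using cp p by (subst epow_add[symmetric]) (auto simp: algebra_simps)
      then show ?thesis by (simp add: grid_integrand_def mult_ac)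
    qed
    finally show "(\<integral>\<^sup>+y. grid_integrand (insert i I) p f (x(i := y)) \<partial>lborel) \<le> grid_integrand I p g x" .
  qed
  also have "\<dots> \<le> epow (\<integral>\<^sup>+x. g x \<partial>Pi\<^sub>M I (\<lambda>_. lborel)) (1 + p)"
    using insert.IH[OF p cp' gm] .
  also have "(\<integral>\<^sup>+x. g x \<partial>Pi\<^sub>M I (\<lambda>_. lborel)) = (\<integral>\<^sup>+x. f x \<partial>Pi\<^sub>M (insert i I) (\<lambda>_. lborel))"
    unfolding g_def using insert.hyps fm by (intro P.product_nn_integral_insert[symmetric])
  finally show ?case .
qed

section \<open>The inequality of Gagliardo, Nirenberg and Sobolev\<close>

lemma increment_le_nn_integral:
  fixes F f :: "real \<Rightarrow> real"
  assumes "a \<le> b" and "\<And>t. (F has_real_derivative f t) (at t)" and "continuous_on UNIV f"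
  shows "ennreal \<bar>F b - F a\<bar> \<le> (\<integral>\<^sup>+t. ennreal \<bar>f t\<bar> * indicator {a..b} t \<partial>lborel)"
proof -
  have "has_bochner_integral lborel (\<lambda>t. indicator {a..b} t *\<^sub>R f t) (F b - F a)"
    using assms
    by (intro has_bochner_integral_FTC_Icc)
       (auto simp flip: has_real_derivative_iff_has_vector_derivative intro: has_field_derivative_at_within continuous_on_subset)
  from has_bochner_integral_norm_bound[OF this]
  have "ennreal \<bar>F b - F a\<bar> \<le> (\<integral>\<^sup>+t. ennreal \<bar>indicator {a..b} t * f t\<bar> \<partial>lborel)" by simp
  also have "\<dots> = (\<integral>\<^sup>+t. ennreal \<bar>f t\<bar> * indicator {a..b} t \<partial>lborel)"
    by (intro nn_integral_cong) (auto split: split_indicator)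
  finally show ?thesis .
qed

text \<open>
  The signed power is used in place of \<open>|v|\<^sup>\<gamma>\<close>, which has the same absolute value: at exponent 1 it is
  the identity, hence still differentiable at 0.
\<close>
lemma has_real_derivative_signed_powr:
  fixes \<gamma> v :: real
  assumes "1 < \<gamma>"
  shows "((\<lambda>v. sgn v * \<bar>v\<bar> powr \<gamma>) has_real_derivative \<gamma> * \<bar>v\<bar> powr (\<gamma> - 1)) (at v)"
proof -
  consider "v > 0" | "v < 0" | "v = 0" by linarith
  then show ?thesis
  proof cases
    case 1
    have "((\<lambda>v. v powr \<gamma>) has_real_derivative \<gamma> * \<bar>v\<bar> powr (\<gamma> - 1)) (at v)"
      using 1 by (auto intro!: derivative_eq_intros)
    then show ?thesis
      by (rule has_field_derivative_transform_within_open[where S="{0<..}"]) (use 1 in auto)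
  next
    case 2
    have "((\<lambda>v. - ((- v) powr \<gamma>)) has_real_derivative \<gamma> * \<bar>v\<bar> powr (\<gamma> - 1)) (at v)"
      using 2 by (auto intro!: derivative_eq_intros)
    then show ?thesis
      by (rule has_field_derivative_transform_within_open[where S="{..<0}"]) (use 2 in auto)
  next
    case 3
    have "((\<lambda>h::real. \<bar>h\<bar> powr (\<gamma> - 1)) \<longlongrightarrow> \<bar>0\<bar> powr (\<gamma> - 1)) (at 0)"
      using assms by (intro tendsto_powr2 tendsto_intros) auto
    moreover have "eventually (\<lambda>h::real. \<bar>h\<bar> powr (\<gamma> - 1) = (sgn h * \<bar>h\<bar> powr \<gamma>) / h) (at 0)"
    proof (rule eventually_at_topological[THEN iffD2], intro exI[of _ UNIV] conjI ballI impI)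
      fix h :: real assume "h \<noteq> 0"
      then show "\<bar>h\<bar> powr (\<gamma> - 1) = (sgn h * \<bar>h\<bar> powr \<gamma>) / h"
        by (cases "h > 0") (auto simp: powr_diff)
    qed auto
    ultimately have "((\<lambda>h::real. (sgn h * \<bar>h\<bar> powr \<gamma>) / h) \<longlongrightarrow> 0) (at 0)"
      using filterlim_cong[OF refl refl] by force
    then show ?thesis using 3 by (simp add: has_field_derivative_iff)
  qed
qed

text \<open>
  Start the line at a point outside the support of \<open>u\<close> and integrate the derivative of the signed
  power of \<open>u\<close> up to the point in question.
\<close>
lemma powr_le_nn_integral_line:
  fixes u :: "'a::euclidean_space \<Rightarrow> real" and G :: "'a \<Rightarrow> 'a"
  assumes der: "\<And>x. (u has_derivative (\<lambda>h. G x \<bullet> h)) (at x)" and G: "continuous_on UNIV G"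
    and R: "\<And>x. u x \<noteq> 0 \<Longrightarrow> norm x \<le> R" and \<gamma>: "1 \<le> \<gamma>" and b: "norm b = 1"
  shows "epow (ennreal \<bar>u (y + s *\<^sub>R b)\<bar>) \<gamma>
     \<le> (\<integral>\<^sup>+t. ennreal \<gamma> * (epow (ennreal \<bar>u (y + t *\<^sub>R b)\<bar>) (\<gamma> - 1) * ennreal (norm (G (y + t *\<^sub>R b)))) \<partial>lborel)"
proof -
  (* The case distinction is needed for the derivative: at exponent 1 it is the constant 1, whereas
     0 powr 0 = 0. *)
  define \<phi> where "\<phi> v = (if \<gamma> = 1 then v else sgn v * \<bar>v\<bar> powr \<gamma>)" for v :: real
  define \<psi> where "\<psi> v = (if \<gamma> = 1 then 1 else \<gamma> * \<bar>v\<bar> powr (\<gamma> - 1))" for v :: real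
  have \<phi>': "(\<phi> has_real_derivative \<psi> v) (at v)" for v
    using has_real_derivative_signed_powr[of \<gamma> v] \<gamma>
    by (cases "\<gamma> = 1") (auto simp: \<phi>_def[abs_def] \<psi>_def)
  have \<psi>: "continuous_on UNIV \<psi>"
    using \<gamma> unfolding \<psi>_def[abs_def] by (cases "\<gamma> = 1") (auto intro!: continuous_intros continuous_on_powr')
  define l where "l t = y + t *\<^sub>R b" for t
  have l': "(l has_derivative (\<lambda>h. h *\<^sub>R b)) (at t)" for t
    unfolding l_def[abs_def] by (auto intro!: derivative_eq_intros)
  have ul: "((\<lambda>t. u (l t)) has_real_derivative G (l t) \<bullet> b) (at t)" for t
    using has_derivative_compose[OF l' der]
    by (rule has_derivative_imp_has_field_derivative) simp
  have ucont: "continuous_on UNIV u"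
    using der by (meson has_derivative_continuous continuous_at_imp_continuous_on)
  have lcont: "continuous_on UNIV l" unfolding l_def[abs_def] by (intro continuous_intros)
  have h: "((\<lambda>t. \<phi> (u (l t))) has_real_derivative \<psi> (u (l t)) * (G (l t) \<bullet> b)) (at t)" for t
    using DERIV_chain2[OF \<phi>' ul] .
  have hc: "continuous_on UNIV (\<lambda>t. \<psi> (u (l t)) * (G (l t) \<bullet> b))"
    by (intro continuous_intros continuous_on_compose2[OF \<psi>] continuous_on_compose2[OF ucont]
       continuous_on_compose2[OF G] lcont) auto
  define a where "a = - (\<bar>R\<bar> + norm y + \<bar>s\<bar> + 1)"
  have "norm (l a) > R"
  proof -
    have "norm (l a) \<ge> norm (a *\<^sub>R b) - norm y"
      unfolding l_def by (metis add.commute norm_diff_ineq)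
    moreover have "norm (a *\<^sub>R b) = \<bar>R\<bar> + norm y + \<bar>s\<bar> + 1" unfolding a_def using b norm_ge_zero[of y] by (simp only: norm_scaleR mult_1_right)
    ultimately show ?thesis by linarith
  qed
  then have "u (l a) = 0" using R[of "l a"] by force
  then have a0: "\<phi> (u (l a)) = 0" by (simp add: \<phi>_def)
  have as: "a \<le> s" using norm_ge_zero[of y] unfolding a_def by linarith
  have "epow (ennreal \<bar>u (l s)\<bar>) \<gamma> = ennreal \<bar>\<phi> (u (l s)) - \<phi> (u (l a))\<bar>"
    using \<gamma> unfolding a0 by (simp add: \<phi>_def epow_ennreal abs_mult abs_sgn_eq)
  also have "\<dots> \<le> (\<integral>\<^sup>+t. ennreal \<bar>\<psi> (u (l t)) * (G (l t) \<bullet> b)\<bar> * indicator {a..s} t \<partial>lborel)"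
    using increment_le_nn_integral[OF as h hc] .
  also have "\<dots> \<le> (\<integral>\<^sup>+t. ennreal \<gamma> * (epow (ennreal \<bar>u (l t)\<bar>) (\<gamma> - 1) * ennreal (norm (G (l t)))) \<partial>lborel)"
  proof (rule nn_integral_mono)
    fix t
    have e: "ennreal (\<psi> v) = ennreal \<gamma> * epow (ennreal \<bar>v\<bar>) (\<gamma> - 1)" for v
      using \<gamma> by (cases "\<gamma> = 1") (auto simp: \<psi>_def epow_ennreal ennreal_mult)
    have \<psi>0: "\<psi> v \<ge> 0" for v using \<gamma> by (simp add: \<psi>_def)
    have "ennreal \<bar>\<psi> (u (l t)) * (G (l t) \<bullet> b)\<bar> * indicator {a..s} t \<le> ennreal (\<psi> (u (l t)) * norm (G (l t)))"
      using Cauchy_Schwarz_ineq2[of "G (l t)" b] b \<psi>0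
      by (auto split: split_indicator simp: abs_mult intro!: ennreal_leI mult_left_mono)
    also have "\<dots> = ennreal \<gamma> * (epow (ennreal \<bar>u (l t)\<bar>) (\<gamma> - 1) * ennreal (norm (G (l t))))"
      using \<psi>0 by (simp add: ennreal_mult e mult.assoc)
    finally show "ennreal \<bar>\<psi> (u (l t)) * (G (l t) \<bullet> b)\<bar> * indicator {a..s} t
      \<le> ennreal \<gamma> * (epow (ennreal \<bar>u (l t)\<bar>) (\<gamma> - 1) * ennreal (norm (G (l t))))" .
  qed
  finally show ?thesis unfolding l_def .
qed

lemma prod_mono_ennreal:
  fixes f g :: "'i \<Rightarrow> ennreal"
  assumes "\<And>i. i \<in> A \<Longrightarrow> f i \<le> g i"
  shows "prod f A \<le> prod g A"
  using assms by (induction A rule: infinite_finite_induct) (auto intro!: mult_mono)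

text \<open>
  The exponent \<open>\<gamma> (1 + s)\<close> is \<open>n\<close> times \<open>\<gamma> s\<close>, so the integrand on the left is the product of \<open>n\<close> copies of
  the \<open>s\<close>-th power of \<open>|u|\<^sup>\<gamma>\<close>. Each copy is bounded by means of the line in another coordinate direction,
  and the grid-lines inequality applies to the product.
\<close>
lemma nn_integral_powr_le_gradient:
  fixes u :: "'a::euclidean_space \<Rightarrow> real" and G :: "'a \<Rightarrow> 'a"
  assumes dim: "2 \<le> DIM('a)"
    and der: "\<And>x. (u has_derivative (\<lambda>h. G x \<bullet> h)) (at x)" and G: "continuous_on UNIV G"
    and R: "\<And>x. u x \<noteq> 0 \<Longrightarrow> norm x \<le> R" and \<gamma>: "1 \<le> \<gamma>"
  defines "s \<equiv> 1 / (real DIM('a) - 1)"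
  shows "(\<integral>\<^sup>+x. epow (ennreal \<bar>u x\<bar>) (\<gamma> * (1 + s)) \<partial>lborel)
    \<le> epow (ennreal \<gamma> * (\<integral>\<^sup>+x. epow (ennreal \<bar>u x\<bar>) (\<gamma> - 1) * ennreal (norm (G x)) \<partial>lborel)) (1 + s)"
proof -
  define H where "H x = ennreal \<gamma> * (epow (ennreal \<bar>u x\<bar>) (\<gamma> - 1) * ennreal (norm (G x)))" for x
  define pt where "pt z = (\<Sum>b\<in>Basis. z b *\<^sub>R b :: 'a)" for z
  let ?P = "Pi\<^sub>M (Basis :: 'a set) (\<lambda>_. lborel :: real measure)"
  have ucont: "continuous_on UNIV u"
    using der by (meson has_derivative_continuous continuous_at_imp_continuous_on)
  have [measurable]: "u \<in> borel_measurable borel" "G \<in> borel_measurable borel"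
    using ucont G by (auto intro: borel_measurable_continuous_onI)
  have Hm [measurable]: "H \<in> borel_measurable borel"
    unfolding H_def by measurable
  have ptm [measurable]: "pt \<in> ?P \<rightarrow>\<^sub>M borel"
    unfolding pt_def[abs_def] by measurable
  have int_pt: "(\<integral>\<^sup>+x. g x \<partial>lborel) = (\<integral>\<^sup>+z. g (pt z) \<partial>?P)"
    if [measurable]: "g \<in> borel_measurable borel" for g :: "'a \<Rightarrow> ennreal"
    by (subst lborel_eq, subst nn_integral_distr) (use ptm in \<open>auto simp: pt_def[abs_def]\<close>)
  have s: "s > 0" "1 + s = real DIM('a) * s" "(real DIM('a) - 1) * s = 1"
    using dim by (auto simp: s_def field_simps)
  have "(\<integral>\<^sup>+x. epow (ennreal \<bar>u x\<bar>) (\<gamma> * (1 + s)) \<partial>lborel) = (\<integral>\<^sup>+z. epow (ennreal \<bar>u (pt z)\<bar>) (\<gamma> * (1 + s)) \<partial>?P)"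
    by (rule int_pt) measurable
  also have "\<dots> \<le> (\<integral>\<^sup>+z. grid_integrand Basis s (\<lambda>z. H (pt z)) z \<partial>?P)"
  proof (rule nn_integral_mono)
    fix z
    have "epow (ennreal \<bar>u (pt z)\<bar>) (\<gamma> * (1 + s)) = (\<Prod>b\<in>(Basis::'a set). epow (epow (ennreal \<bar>u (pt z)\<bar>) \<gamma>) s)"
    proof -
      have "(\<Prod>b\<in>B. epow x p) = epow x (real (card B) * p)" if "0 \<le> p" for x p and B :: "'a set"
        using that by (induction B rule: infinite_finite_induct) (auto simp: epow_add[symmetric] algebra_simps)
      then show ?thesis using \<gamma> s(1) by (simp add: s(2) epow_epow mult_ac)
    qed
    also have "\<dots> \<le> (\<Prod>b\<in>(Basis::'a set). epow (\<integral>\<^sup>+t. H (pt (z(b := t))) \<partial>lborel) s)"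
    proof (intro prod_mono_ennreal epow_mono)
      fix b :: 'a assume b: "b \<in> Basis"
      have upd: "pt (z(b := t)) = pt (z(b := 0)) + t *\<^sub>R b" for t
        using b unfolding pt_def by (subst (1 2) sum.remove[of Basis b]) (auto simp: intro!: sum.cong)
      define y where "y = pt (z(b := 0))"
      have y: "pt (z(b := t)) = y + t *\<^sub>R b" for t
        unfolding y_def by (rule upd)
      have "pt z = y + z b *\<^sub>R b"
        using y[of "z b"] by simp
      then show "epow (ennreal \<bar>u (pt z)\<bar>) \<gamma> \<le> (\<integral>\<^sup>+t. H (pt (z(b := t))) \<partial>lborel)"
        using powr_le_nn_integral_line[OF der G R \<gamma>, of b y "z b"] b
        unfolding y H_def by simp
    qed (use s in auto)
    also have "\<dots> = grid_integrand Basis s (\<lambda>z. H (pt z)) z"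
      by (simp add: grid_integrand_def s(3))
    finally show "epow (ennreal \<bar>u (pt z)\<bar>) (\<gamma> * (1 + s)) \<le> grid_integrand Basis s (\<lambda>z. H (pt z)) z" .
  qed
  also have "\<dots> \<le> epow (\<integral>\<^sup>+z. H (pt z) \<partial>?P) (1 + s)"
    using s by (intro grid_lines_inequality) auto
  also have "(\<integral>\<^sup>+z. H (pt z) \<partial>?P) = (\<integral>\<^sup>+x. H x \<partial>lborel)"
    by (rule int_pt[symmetric]) measurable
  also have "\<dots> = ennreal \<gamma> * (\<integral>\<^sup>+x. epow (ennreal \<bar>u x\<bar>) (\<gamma> - 1) * ennreal (norm (G x)) \<partial>lborel)"
    unfolding H_def by (intro nn_integral_cmult) measurable
  finally show ?thesis .
qed

text \<open>
  The finiteness is what permits the cancellation in the Gagliardo-Nirenberg-Sobolev inequality.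
\<close>
lemma nn_integral_epow_bounded_support_finite:
  fixes u :: "'a::euclidean_space \<Rightarrow> 'b::real_normed_vector"
  assumes u: "continuous_on UNIV u" and R: "\<And>x. u x \<noteq> 0 \<Longrightarrow> norm x \<le> R" and q: "0 < q"
  shows "(\<integral>\<^sup>+x. epow (ennreal (norm (u x))) q \<partial>lborel) < top"
proof -
  have "compact (u ` cball 0 R)"
    using u by (intro compact_continuous_image) (auto intro: continuous_on_subset)
  then have "bounded (u ` cball 0 R)" by (rule compact_imp_bounded)
  then obtain B where B: "B > 0" "\<And>x. x \<in> cball 0 R \<Longrightarrow> norm (u x) \<le> B"
    unfolding bounded_pos by blast
  have "(\<integral>\<^sup>+x. epow (ennreal (norm (u x))) q \<partial>lborel) \<le> (\<integral>\<^sup>+x. epow (ennreal B) q * indicator (cball 0 R :: 'a set) x \<partial>lborel)"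
  proof (rule nn_integral_mono)
    fix x
    show "epow (ennreal (norm (u x))) q \<le> epow (ennreal B) q * indicator (cball 0 R) x"
    proof (cases "x \<in> cball 0 R")
      case True
      then show ?thesis using B q by (auto intro!: epow_mono ennreal_leI)
    next
      case False
      then have "u x = 0" using R[of x] by force
      then show ?thesis using q by simp
    qed
  qed
  also have "\<dots> = epow (ennreal B) q * emeasure lborel (cball 0 R :: 'a set)"
    by (simp add: nn_integral_cmult_indicator)
  also have "\<dots> < top"
    using B q emeasure_lborel_cball_finite[of "0::'a" R]
    by (simp add: epow_ennreal_pos ennreal_mult_less_top)
  finally show ?thesis .
qed

text \<open>
  The exponent \<open>\<gamma>\<close> solves \<open>\<gamma> n / (n - 1) = 1 / q\<close>. Then also \<open>\<gamma> - 1 = (1 - r) / q\<close>, so that Hoelder's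
  inequality for \<open>|u|\<^bsup>\<gamma>-1\<^esup> |G|\<close> produces the integral \<open>A\<close> of \<open>|u|\<^bsup>1/q\<^esup>\<close> on the right-hand side too, with the
  smaller exponent \<open>1 - r\<close> in place of \<open>1 - 1/n\<close>; the difference of the two exponents is \<open>q\<close>.
\<close>
theorem Gagliardo_Nirenberg_Sobolev:
  fixes u :: "'a::euclidean_space \<Rightarrow> real" and G :: "'a \<Rightarrow> 'a"
  assumes dim: "2 \<le> DIM('a)"
    and der: "\<And>x. (u has_derivative (\<lambda>h. G x \<bullet> h)) (at x)" and G: "continuous_on UNIV G"
    and R: "\<And>x. u x \<noteq> 0 \<Longrightarrow> norm x \<le> R"
    and r: "1 / real DIM('a) < r" "r \<le> 1"
  defines "\<gamma> \<equiv> (real DIM('a) - 1) / (real DIM('a) * r - 1)"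
    and "q \<equiv> r - 1 / real DIM('a)"
  shows "Lp_seminorm lborel q (\<lambda>x. ennreal \<bar>u x\<bar>)
     \<le> ennreal \<gamma> * Lp_seminorm lborel r (\<lambda>x. ennreal (norm (G x)))"
proof -
  define n where "n = real DIM('a)"
  have n: "n \<ge> 2" using dim by (simp add: n_def)
  have nr: "n * r > 1" using r n by (simp add: n_def[symmetric] field_simps)
  have r0: "r > 0" using r(1) by (smt (verit) divide_nonneg_nonneg of_nat_0_le_iff)
  have q0: "q > 0" using r by (simp add: q_def)
  have \<gamma>1: "\<gamma> \<ge> 1" using nr n r(2) mult_left_mono[OF r(2), of n]
    by (simp add: \<gamma>_def n_def[symmetric] field_simps)
  define s where "s = 1 / (n - 1)"
  have qeq: "q = (n * r - 1) / n" using n by (simp add: q_def n_def[symmetric] field_simps)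
  have seq: "1 + s = n / (n - 1)" using n by (simp add: s_def field_simps)
  have gs: "\<gamma> * (1 + s) = 1 / q"
    using n nr unfolding qeq seq \<gamma>_def n_def[symmetric] by simp
  have g1: "\<gamma> - 1 = 1 / q * (1 - r)"
    using n nr unfolding qeq \<gamma>_def n_def[symmetric] by (simp add: field_simps)
  have ucont: "continuous_on UNIV u"
    using der by (meson has_derivative_continuous continuous_at_imp_continuous_on)
  have [measurable]: "u \<in> borel_measurable borel" "G \<in> borel_measurable borel"
    using ucont G by (auto intro: borel_measurable_continuous_onI)
  define A where "A = (\<integral>\<^sup>+x. epow (ennreal \<bar>u x\<bar>) (1 / q) \<partial>lborel)"
  define N where "N = epow (\<integral>\<^sup>+x. epow (ennreal (norm (G x))) (1 / r) \<partial>lborel) r"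
  have Afin: "A < top"
    unfolding A_def using nn_integral_epow_bounded_support_finite[OF ucont R, of "1 / q"] q0 by simp
  have "A \<le> epow (ennreal \<gamma> * (\<integral>\<^sup>+x. epow (ennreal \<bar>u x\<bar>) (\<gamma> - 1) * ennreal (norm (G x)) \<partial>lborel)) (1 + s)"
    using nn_integral_powr_le_gradient[OF dim der G R \<gamma>1]
    unfolding A_def n_def[symmetric] s_def[symmetric] gs .
  also have "\<dots> \<le> epow (ennreal \<gamma> * (epow A (1 - r) * N)) (1 + s)"
  proof (intro epow_mono mult_left_mono)
    have "(\<integral>\<^sup>+x. epow (ennreal \<bar>u x\<bar>) (\<gamma> - 1) * ennreal (norm (G x)) \<partial>lborel)
       = (\<integral>\<^sup>+x. epow (epow (ennreal \<bar>u x\<bar>) (1 / q)) (1 - r) * epow (epow (ennreal (norm (G x))) (1 / r)) r \<partial>lborel)"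
      using q0 r r0 unfolding g1 by (simp add: epow_epow)
    also have "\<dots> \<le> epow A (1 - r) * N"
      unfolding A_def N_def using r r0 by (intro nn_integral_Holder) auto
    finally show "(\<integral>\<^sup>+x. epow (ennreal \<bar>u x\<bar>) (\<gamma> - 1) * ennreal (norm (G x)) \<partial>lborel) \<le> epow A (1 - r) * N" .
  qed (use n in \<open>auto simp: s_def\<close>)
  finally have "epow A (1 - 1 / n) \<le> epow (epow (ennreal \<gamma> * (epow A (1 - r) * N)) (1 + s)) (1 - 1 / n)"
    using n by (intro epow_mono) auto
  also have "\<dots> = ennreal \<gamma> * (epow A (1 - r) * N)"
  proof -
    have "(1 + s) * (1 - 1 / n) = 1" using n unfolding seq by (simp add: field_simps)
    then show ?thesis using n by (subst epow_epow) (auto simp: s_def)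
  qed
  also have "epow A (1 - 1 / n) = epow A (1 - r) * epow A q"
    using r q0 by (subst epow_add[symmetric]) (auto simp: q_def n_def)
  finally have le: "epow A (1 - r) * epow A q \<le> epow A (1 - r) * (ennreal \<gamma> * N)"
    by (simp add: mult_ac)
  show ?thesis
  proof (cases "A = 0")
    case True
    then show ?thesis using q0 by (simp add: A_def[symmetric] Lp_seminorm_def)
  next
    case False
    then have "epow A (1 - r) \<noteq> 0" "epow A (1 - r) \<noteq> top"
      using Afin r by (cases "r = 1"; simp add: epow_eq_0_iff epow_eq_top_iff)+
    then have "epow A q \<le> ennreal \<gamma> * N"
      using le by (simp add: ennreal_mult_le_mult_iff)
    then show ?thesis by (simp add: A_def N_def Lp_seminorm_def)
  qed
qed

section \<open>Morrey's inequality\<close>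

lemma nn_integral_lborel_affine:
  fixes f :: "'a::euclidean_space \<Rightarrow> ennreal"
  assumes [measurable]: "f \<in> borel_measurable borel" and c: "c \<noteq> 0"
  shows "(\<integral>\<^sup>+x. f x \<partial>lborel) = ennreal (\<bar>c\<bar> ^ DIM('a)) * (\<integral>\<^sup>+x. f (t + c *\<^sub>R x) \<partial>lborel)"
  by (subst lborel_affine[OF c, of t])
     (simp add: nn_integral_density nn_integral_distr nn_integral_cmult)

lemma nn_integral_powr_unit_interval:
  assumes "(\<alpha>::real) < 1"
  shows "(\<integral>\<^sup>+t. ennreal (t powr (-\<alpha>)) * indicator {0..1} t \<partial>lborel) = ennreal (1 / (1 - \<alpha>))"
proof -
  have "((\<lambda>t. t powr (-\<alpha>)) has_integral 1 / (1 - \<alpha>)) {0..1}"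
    using has_integral_powr_from_0[of "-\<alpha>" 1] assms by (simp add: add.commute)
  from nn_integral_has_integral_lebesgue[OF _ this]
  have "(\<integral>\<^sup>+t. ennreal (indicator {0..1} t * t powr (-\<alpha>)) \<partial>lborel) = ennreal (1 / (1 - \<alpha>))"
    by (simp add: nn_integral_completion)
  then show ?thesis
    by (subst nn_integral_cong[where v="\<lambda>t. ennreal (indicator {0..1} t * t powr (-\<alpha>))"])
       (auto split: split_indicator)
qed

lemma increment_le_nn_integral_segment:
  fixes u :: "'a::euclidean_space \<Rightarrow> real" and G :: "'a \<Rightarrow> 'a"
  assumes der: "\<And>x. (u has_derivative (\<lambda>h. G x \<bullet> h)) (at x)" and G: "continuous_on UNIV G"
  shows "ennreal \<bar>u z - u x\<bar>
    \<le> (\<integral>\<^sup>+t. ennreal (norm (z - x)) * (ennreal (norm (G (x + t *\<^sub>R (z - x)))) * indicator {0..1} t) \<partial>lborel)"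
proof -
  define l where "l t = x + t *\<^sub>R (z - x)" for t
  have l': "(l has_derivative (\<lambda>h. h *\<^sub>R (z - x))) (at t)" for t
    unfolding l_def[abs_def] by (auto intro!: derivative_eq_intros)
  have ul: "((\<lambda>t. u (l t)) has_real_derivative G (l t) \<bullet> (z - x)) (at t)" for t
    using has_derivative_compose[OF l' der]
    by (rule has_derivative_imp_has_field_derivative) simp
  have lcont: "continuous_on UNIV l" unfolding l_def[abs_def] by (intro continuous_intros)
  have "ennreal \<bar>u (l 1) - u (l 0)\<bar> \<le> (\<integral>\<^sup>+t. ennreal \<bar>G (l t) \<bullet> (z - x)\<bar> * indicator {0..1} t \<partial>lborel)"
    by (rule increment_le_nn_integral[OF _ ul])
       (auto intro!: continuous_intros continuous_on_compose2[OF G] lcont)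
  also have "\<dots> \<le> (\<integral>\<^sup>+t. ennreal (norm (z - x)) * (ennreal (norm (G (l t))) * indicator {0..1} t) \<partial>lborel)"
    using Cauchy_Schwarz_ineq2[of _ "z - x"]
    by (intro nn_integral_mono) (auto split: split_indicator simp: ennreal_mult[symmetric] mult.commute intro!: ennreal_leI)
  finally show ?thesis by (simp add: l_def)
qed

text \<open>
  Bound \<open>|u(z) - u(x)|\<close> by the integral of the gradient over the segment from \<open>x\<close> to \<open>z\<close>, integrate over
  the ball, and exchange the integrals. For a fixed parameter \<open>t\<close> on the segment, Hoelder's inequality
  on the ball and the substitution \<open>z \<mapsto> x + t (z - x)\<close>, whose Jacobian is \<open>t\<^sup>n\<close>, produce the factor
  \<open>t\<^bsup>-nr\<^esup>\<close>. It is integrable over the unit interval because \<open>n r < 1\<close>.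
\<close>
lemma Morrey_ball_estimate:
  fixes u :: "'a::euclidean_space \<Rightarrow> real" and G :: "'a \<Rightarrow> 'a"
  assumes der: "\<And>x. (u has_derivative (\<lambda>h. G x \<bullet> h)) (at x)" and G: "continuous_on UNIV G"
    and r: "0 < r" "real DIM('a) * r < 1" and x: "x \<in> cball m \<rho>"
  shows "(\<integral>\<^sup>+z. ennreal \<bar>u z - u x\<bar> * indicator (cball m \<rho>) z \<partial>lborel)
    \<le> ennreal (2 * \<rho> / (1 - real DIM('a) * r)) * (epow (emeasure lborel (cball m \<rho>)) (1 - r)
         * Lp_seminorm lborel r (\<lambda>x. ennreal (norm (G x))))"
proof -
  define n where "n = real DIM('a)"
  have n1: "n \<ge> 1" by (simp add: n_def Suc_leI)
  have r1: "r \<le> 1" using r(2) mult_right_mono[OF n1 less_imp_le[OF r(1)]] unfolding n_def by linarith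
  have \<rho>: "\<rho> \<ge> 0" using x zero_le_dist[of m x] by (simp only: mem_cball)
  let ?B = "cball m \<rho>"
  define N where "N = epow (\<integral>\<^sup>+x. epow (ennreal (norm (G x))) (1 / r) \<partial>lborel) r"
  define V where "V = epow (emeasure lborel ?B) (1 - r)"
  have ucont: "continuous_on UNIV u"
    using der by (meson has_derivative_continuous continuous_at_imp_continuous_on)
  have [measurable]: "u \<in> borel_measurable borel" "G \<in> borel_measurable borel" "?B \<in> sets borel"
    using ucont G by (auto intro: borel_measurable_continuous_onI)
  have "(\<integral>\<^sup>+z. ennreal \<bar>u z - u x\<bar> * indicator ?B z \<partial>lborel)
     \<le> (\<integral>\<^sup>+z. (\<integral>\<^sup>+t. ennreal (2 * \<rho>) * (ennreal (norm (G (x + t *\<^sub>R (z - x)))) * indicator ?B z * indicator {0..1} t) \<partial>lborel) \<partial>lborel)"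
  proof (intro nn_integral_mono)
    fix z
    show "ennreal \<bar>u z - u x\<bar> * indicator ?B z
       \<le> (\<integral>\<^sup>+t. ennreal (2 * \<rho>) * (ennreal (norm (G (x + t *\<^sub>R (z - x)))) * indicator ?B z * indicator {0..1} t) \<partial>lborel)"
    proof (cases "z \<in> ?B")
      case True
      have "norm (z - x) \<le> 2 * \<rho>"
        using True x dist_triangle3[of z x m] by (simp add: dist_norm[symmetric])
      then have "(\<integral>\<^sup>+t. ennreal (norm (z - x)) * (ennreal (norm (G (x + t *\<^sub>R (z - x)))) * indicator {0..1} t) \<partial>lborel)
         \<le> (\<integral>\<^sup>+t. ennreal (2 * \<rho>) * (ennreal (norm (G (x + t *\<^sub>R (z - x)))) * indicator {0..1} t) \<partial>lborel)"
        by (intro nn_integral_mono mult_right_mono ennreal_leI) auto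
      with increment_le_nn_integral_segment[OF der G, of z x] True show ?thesis by simp
    qed simp
  qed
  also have "\<dots> = (\<integral>\<^sup>+t. (\<integral>\<^sup>+z. ennreal (2 * \<rho>) * (ennreal (norm (G (x + t *\<^sub>R (z - x)))) * indicator ?B z * indicator {0..1} t) \<partial>lborel) \<partial>lborel)"
    by (rule lborel_pair.Fubini') measurable
  also have "\<dots> \<le> (\<integral>\<^sup>+t. ennreal (2 * \<rho>) * (V * N) * (ennreal (t powr (- (n * r))) * indicator {0..1} t) \<partial>lborel)"
  proof (rule nn_integral_mono_AE)
    show "AE t in lborel. (\<integral>\<^sup>+z. ennreal (2 * \<rho>) * (ennreal (norm (G (x + t *\<^sub>R (z - x)))) * indicator ?B z * indicator {0..1} t) \<partial>lborel)
       \<le> ennreal (2 * \<rho>) * (V * N) * (ennreal (t powr (- (n * r))) * indicator {0..1} t)"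
      using AE_lborel_singleton[of "0::real"]
    proof eventually_elim
      (* The parameter 0 has to be excluded: there the substitution degenerates and 0 powr a = 0. *)
      case (elim t)
      show ?case
      proof (cases "t \<in> {0..1}")
        case True
        then have t: "t > 0" using elim by simp
        define K where "K = (\<integral>\<^sup>+z. epow (ennreal (norm (G (x + t *\<^sub>R (z - x))))) (1 / r) \<partial>lborel)"
        have "(\<integral>\<^sup>+x. epow (ennreal (norm (G x))) (1 / r) \<partial>lborel)
           = ennreal (\<bar>t\<bar> ^ DIM('a)) * (\<integral>\<^sup>+z. epow (ennreal (norm (G ((x - t *\<^sub>R x) + t *\<^sub>R z)))) (1 / r) \<partial>lborel)"
          using t by (intro nn_integral_lborel_affine) auto
        also have "(\<integral>\<^sup>+z. epow (ennreal (norm (G ((x - t *\<^sub>R x) + t *\<^sub>R z)))) (1 / r) \<partial>lborel) = K"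
          by (simp add: K_def algebra_simps)
        finally have "N = epow (ennreal (t powr n)) r * epow K r"
          using t r by (simp add: N_def epow_mult powr_realpow n_def)
        then have "ennreal (t powr (- (n * r))) * N = (ennreal (t powr (- (n * r))) * ennreal (t powr (n * r))) * epow K r"
          using t by (simp add: epow_ennreal_pos powr_powr mult.assoc)
        also have "ennreal (t powr (- (n * r))) * ennreal (t powr (n * r)) = 1"
          using t by (simp add: ennreal_mult[symmetric] powr_add[symmetric])
        finally have KN: "epow K r = ennreal (t powr (- (n * r))) * N" by simp
        have "(\<integral>\<^sup>+z. ennreal (norm (G (x + t *\<^sub>R (z - x)))) * indicator ?B z \<partial>lborel)
          = (\<integral>\<^sup>+z. epow (indicator ?B z) (1 - r) * epow (epow (ennreal (norm (G (x + t *\<^sub>R (z - x))))) (1 / r) * indicator ?B z) r \<partial>lborel)"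
          using r r1 by (intro nn_integral_cong) (auto simp: epow_epow split: split_indicator)
        also have "\<dots> \<le> epow (\<integral>\<^sup>+z. indicator ?B z \<partial>lborel) (1 - r)
            * epow (\<integral>\<^sup>+z. epow (ennreal (norm (G (x + t *\<^sub>R (z - x))))) (1 / r) * indicator ?B z \<partial>lborel) r"
          using r r1 by (intro nn_integral_Holder) auto
        also have "\<dots> \<le> V * epow K r"
          unfolding V_def K_def using r r1
          by (intro mult_mono epow_mono nn_integral_mono) (auto split: split_indicator)
        finally have "(\<integral>\<^sup>+z. ennreal (norm (G (x + t *\<^sub>R (z - x)))) * indicator ?B z \<partial>lborel)
           \<le> V * N * ennreal (t powr (- (n * r)))"
          by (simp add: KN mult_ac)
        then show ?thesis
          using True by (simp add: nn_integral_cmult mult.assoc mult_left_mono)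
      qed simp
    qed
  qed
  also have "\<dots> = ennreal (2 * \<rho>) * (V * N) * ennreal (1 / (1 - n * r))"
    using r by (simp add: nn_integral_cmult nn_integral_powr_unit_interval n_def)
  also have "\<dots> = ennreal (2 * \<rho> / (1 - n * r)) * (V * N)"
  proof -
    have "ennreal (2 * \<rho> / (1 - n * r)) = ennreal (2 * \<rho>) * ennreal (1 / (1 - n * r))"
      using \<rho> r by (simp add: ennreal_mult[symmetric] n_def)
    then show ?thesis by (simp add: mult_ac)
  qed
  finally show ?thesis by (simp add: V_def N_def n_def Lp_seminorm_def)
qed

text \<open>
  Average \<open>|u(x) - u(y)| \<le> |u(z) - u(x)| + |u(z) - u(y)|\<close> over the points \<open>z\<close> of the ball whose diameter is
  the segment from \<open>x\<close> to \<open>y\<close>; both end points lie in this ball.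
\<close>
theorem Morrey_inequality:
  fixes u :: "'a::euclidean_space \<Rightarrow> real" and G :: "'a \<Rightarrow> 'a"
  assumes der: "\<And>x. (u has_derivative (\<lambda>h. G x \<bullet> h)) (at x)" and G: "continuous_on UNIV G"
    and r: "0 < r" "real DIM('a) * r < 1"
  defines "C \<equiv> 4 * unit_ball_vol (real DIM('a)) powr (- r) / (1 - real DIM('a) * r)"
  shows "ennreal \<bar>u x - u y\<bar> \<le> ennreal (C * norm (x - y) powr (1 - real DIM('a) * r))
     * Lp_seminorm lborel r (\<lambda>x. ennreal (norm (G x)))"
proof (cases "x = y")
  case False
  define n where "n = real DIM('a)"
  define N where "N = Lp_seminorm lborel r (\<lambda>x. ennreal (norm (G x)))"
  define \<rho> where "\<rho> = norm (x - y) / 2"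
  define m where "m = midpoint x y"
  define \<omega> where "\<omega> = unit_ball_vol n"
  have \<rho>: "\<rho> > 0" using False by (simp add: \<rho>_def)
  have \<omega>: "\<omega> > 0" by (simp add: \<omega>_def n_def)
  have nr: "n * r < 1" using r by (simp add: n_def)
  have C: "C = 4 * \<omega> powr (- r) / (1 - n * r)" by (simp add: C_def \<omega>_def n_def)
  have C0: "C > 0" using \<omega> nr by (simp add: C)
  have xy: "x \<in> cball m \<rho>" "y \<in> cball m \<rho>"
    using dist_midpoint[of x y] by (simp_all add: m_def \<rho>_def dist_norm)
  define v where "v = \<omega> * \<rho> powr n"
  have v: "v > 0" using \<omega> \<rho> by (simp add: v_def)
  have vol: "emeasure lborel (cball m \<rho>) = ennreal v"
    using \<rho> emeasure_cball[of \<rho> m] by (simp add: v_def \<omega>_def n_def powr_realpow)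
  have ucont: "continuous_on UNIV u"
    using der by (meson has_derivative_continuous continuous_at_imp_continuous_on)
  have [measurable]: "u \<in> borel_measurable borel" "cball m \<rho> \<in> sets borel"
    using ucont by (auto intro: borel_measurable_continuous_onI)
  have "ennreal \<bar>u x - u y\<bar> * ennreal v = (\<integral>\<^sup>+z. ennreal \<bar>u x - u y\<bar> * indicator (cball m \<rho>) z \<partial>lborel)"
    by (simp add: nn_integral_cmult_indicator vol)
  also have "\<dots> \<le> (\<integral>\<^sup>+z. ennreal \<bar>u z - u x\<bar> * indicator (cball m \<rho>) z + ennreal \<bar>u z - u y\<bar> * indicator (cball m \<rho>) z \<partial>lborel)"
    by (intro nn_integral_mono) (auto split: split_indicator simp flip: ennreal_plus intro!: ennreal_leI)
  also have "\<dots> = (\<integral>\<^sup>+z. ennreal \<bar>u z - u x\<bar> * indicator (cball m \<rho>) z \<partial>lborel)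
     + (\<integral>\<^sup>+z. ennreal \<bar>u z - u y\<bar> * indicator (cball m \<rho>) z \<partial>lborel)"
    by (intro nn_integral_add) measurable
  also have "\<dots> \<le> ennreal (2 * \<rho> / (1 - n * r)) * (ennreal (v powr (1 - r)) * N)
        + ennreal (2 * \<rho> / (1 - n * r)) * (ennreal (v powr (1 - r)) * N)"
    using Morrey_ball_estimate[OF der G r xy(1)] Morrey_ball_estimate[OF der G r xy(2)]
    unfolding vol epow_ennreal_pos[OF v] N_def[symmetric] n_def[symmetric] by (rule add_mono)
  also have "\<dots> = ennreal (4 * \<rho> / (1 - n * r) * v powr (1 - r)) * N"
  proof -
    have e: "4 * \<rho> / (1 - n * r) * v powr (1 - r) = 2 * \<rho> / (1 - n * r) * v powr (1 - r) + 2 * \<rho> / (1 - n * r) * v powr (1 - r)"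
      by (simp add: field_simps)
    show ?thesis unfolding e using \<rho> nr
      by (subst ennreal_plus) (auto simp: ennreal_mult[symmetric] distrib_right mult.assoc[symmetric])
  qed
  finally have le: "ennreal \<bar>u x - u y\<bar> * ennreal v \<le> ennreal (4 * \<rho> / (1 - n * r) * v powr (1 - r)) * N" .
  have "ennreal \<bar>u x - u y\<bar> \<le> ennreal (C * \<rho> powr (1 - n * r)) * N"
  proof (cases N)
    case (real \<nu>)
    have "\<bar>u x - u y\<bar> * v \<le> 4 * \<rho> / (1 - n * r) * v powr (1 - r) * \<nu>"
      using le real v \<rho> nr by (simp add: ennreal_mult[symmetric])
    also have "v powr (1 - r) = v * v powr (- r)"
      using v by (simp add: powr_diff powr_minus divide_inverse)
    finally have "\<bar>u x - u y\<bar> * v \<le> (4 * \<rho> / (1 - n * r) * v powr (- r) * \<nu>) * v"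
      by (simp add: mult_ac)
    then have "\<bar>u x - u y\<bar> \<le> 4 * \<rho> / (1 - n * r) * v powr (- r) * \<nu>"
      using v by (simp only: mult_le_cancel_right_pos)
    also have "\<dots> = C * \<rho> powr (1 - n * r) * \<nu>"
      using \<rho> \<omega> by (simp add: C v_def powr_mult powr_powr powr_diff powr_minus divide_inverse)
    finally show ?thesis
      using real C0 by (simp add: ennreal_mult[symmetric] ennreal_leI)
  next
    case top
    then show ?thesis using C0 \<rho> by (simp add: ennreal_mult_top)
  qed
  also have "\<dots> \<le> ennreal (C * norm (x - y) powr (1 - n * r)) * N"
    using C0 nr by (intro mult_right_mono ennreal_leI mult_left_mono powr_mono2) (auto simp: \<rho>_def)
  finally show ?thesis by (simp add: N_def n_def)
qed simp

section \<open>The spaces of the scale\<close>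

lemma X_norm_eq_Lp_seminorm:
  fixes f :: "real^'n::finite \<Rightarrow> 'b::real_normed_vector"
  assumes r: "0 < r"
  shows "X_norm r UNIV f = Lp_seminorm lborel r (\<lambda>x. ennreal (norm (f x)))"
proof -
  have "(\<integral>\<^sup>+x. ennreal (norm (f x) powr (1 / r)) \<partial>lebesgue_on UNIV) = (\<integral>\<^sup>+x. epow (ennreal (norm (f x))) (1 / r) \<partial>lborel)"
    using r by (simp add: lebesgue_on_UNIV_eq nn_integral_completion epow_ennreal)
  then show ?thesis
    using r by (simp add: X_norm_def Lp_norm_def Lp_seminorm_def Let_def epow_def)
qed

lemma mi_order_le_0_iff: "mi_order \<alpha> \<le> 0 \<longleftrightarrow> \<alpha> = (\<lambda>_. 0)"
  by (auto simp: mi_order_def)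

lemma mi_deriv_zero:
  fixes f :: "real^'n::finite \<Rightarrow> 'b::real_normed_vector"
  shows "mi_deriv (\<lambda>_. 0) f = f"
proof -
  have "(SOME is :: 'n list. \<forall>i. count_list is i = 0) = []"
    by (rule some_equality) (auto simp: count_list_0_iff neq_Nil_conv)
  then show ?thesis by (simp add: mi_deriv_def)
qed

lemma hoelder_order_eq_0: "- 1 \<le> real n * r \<Longrightarrow> hoelder_order n r = 0"
  by (simp add: hoelder_order_def le_floor_iff)

lemma hoelder_norm_0:
  fixes f :: "real^'n::finite \<Rightarrow> 'b::real_normed_vector"
  shows "hoelder_norm 0 \<theta> \<Omega> f = (SUP x\<in>\<Omega>. ennreal (norm (f x))) +
     (SUP (x, y)\<in>{(x, y). x \<in> \<Omega> \<and> y \<in> \<Omega> \<and> x \<noteq> y}. ennreal (norm (f x - f y) / norm (x - y) powr \<theta>))"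
proof -
  have "{\<alpha>::'n \<Rightarrow> nat. mi_order \<alpha> \<le> 0} = {\<lambda>_. 0}" "{\<alpha>::'n \<Rightarrow> nat. mi_order \<alpha> = 0} = {\<lambda>_. 0}"
    using mi_order_le_0_iff[where 'a='n] by auto
  then show ?thesis by (simp add: hoelder_norm_def mi_deriv_zero del: le_zero_eq)
qed

context
  fixes u :: "real^'n::finite \<Rightarrow> real" and \<Omega>
  assumes u: "u \<in> Cc_infinity \<Omega>"
begin

lemma Cc_infinity_has_derivative: "(u has_derivative (\<lambda>h. grad u x \<bullet> h)) (at x)"
proof -
  have "Ck_on (Suc 0) UNIV u" using u unfolding Cc_infinity_def by blast
  then have "u differentiable (at x)" by simp
  then have D: "(u has_derivative frechet_derivative u (at x)) (at x)"
    by (simp add: frechet_derivative_works)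
  then interpret L: bounded_linear "frechet_derivative u (at x)"
    by (rule has_derivative_bounded_linear)
  have "frechet_derivative u (at x) h = grad u x \<bullet> h" for h
  proof -
    have "h = (\<Sum>i\<in>UNIV. (h $ i) *\<^sub>R axis i 1)"
      using basis_expansion[of h] by (simp add: scalar_mult_eq_scaleR)
    then have "frechet_derivative u (at x) h = frechet_derivative u (at x) (\<Sum>i\<in>UNIV. (h $ i) *\<^sub>R axis i 1)"
      by (rule arg_cong)
    also have "\<dots> = (\<Sum>i\<in>UNIV. h $ i * frechet_derivative u (at x) (axis i 1))"
      by (simp add: L.sum L.scaleR)
    finally show ?thesis by (simp add: inner_vec_def grad_def partial_deriv_def mult.commute)
  qed
  then show ?thesis using D by (metis ext)
qed

lemma Cc_infinity_continuous: "continuous_on UNIV u"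
  using Cc_infinity_has_derivative by (intro continuous_at_imp_continuous_on ballI has_derivative_continuous)

lemma Cc_infinity_continuous_grad: "continuous_on UNIV (grad u)"
proof -
  have "Ck_on (Suc (Suc 0)) UNIV u" using u unfolding Cc_infinity_def by blast
  then have "partial_deriv i u differentiable (at x)" for i x by simp
  then have "continuous_on UNIV (partial_deriv i u)" for i
    by (intro continuous_at_imp_continuous_on ballI differentiable_imp_continuous_within)
  then show ?thesis unfolding grad_def[abs_def] by (intro continuous_on_vec_lambda)
qed

lemma Cc_infinity_support: "u x \<noteq> 0 \<Longrightarrow> x \<in> \<Omega>"
  using u closure_subset[of "{x. u x \<noteq> 0}"] by (auto simp: Cc_infinity_def)

lemma Cc_infinity_grad_support:
  assumes "grad u x \<noteq> 0" shows "x \<in> \<Omega>"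
proof (rule ccontr)
  assume "x \<notin> \<Omega>"
  then have x: "x \<in> - closure {x. u x \<noteq> 0}" using u by (auto simp: Cc_infinity_def)
  have "(u has_derivative (\<lambda>h. 0)) (at x)"
  proof (rule has_derivative_transform_within_open[OF _ _ x])
    show "((\<lambda>_. 0) has_derivative (\<lambda>h. 0)) (at x)" by simp
    show "0 = u y" if "y \<in> - closure {x. u x \<noteq> 0}" for y
      using that closure_subset[of "{x. u x \<noteq> 0}"] by auto
  qed auto
  then have "(\<lambda>h. grad u x \<bullet> h) = (\<lambda>h. 0)"
    using Cc_infinity_has_derivative has_derivative_unique by blast
  then have "grad u x \<bullet> grad u x = 0" by metis
  then show False using assms by simp
qed

end

lemma WX_space_0I:
  fixes u :: "real^'n::finite \<Rightarrow> real"
  assumes u: "continuous_on UNIV u" and X: "(\<lambda>x. norm x powr (-b) * u x) \<in> X_space r UNIV"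
  shows "u \<in> WX_space 0 r b UNIV"
proof -
  have loc: "locally_integrable_on u UNIV"
    unfolding locally_integrable_on_def
  proof (intro allI impI)
    fix K :: "(real^'n) set" assume K: "compact K \<and> K \<subseteq> UNIV"
    have "integrable lborel (\<lambda>x. indicator K x *\<^sub>R u x)"
      using K u by (intro borel_integrable_compact) (auto intro: continuous_on_subset)
    then show "u absolutely_integrable_on K"
      by (simp add: set_integrable_def integrable_completion borel_measurable_integrable)
  qed
  have "weak_deriv UNIV (\<lambda>_. 0) u u"
    unfolding weak_deriv_def using loc by (simp add: mi_deriv_zero mi_order_def)
  then show ?thesis
    using X unfolding WX_space_def mi_order_le_0_iff by (auto intro!: exI[of _ u] bexI[of _ "\<lambda>x. norm x powr (-b) * u x"])
qed

section \<open>Weights on an annulus\<close>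

lemma bounded_away_from_0_annulus:
  fixes \<Omega> :: "'a::euclidean_space set"
  assumes "bounded \<Omega>" "\<Omega> \<noteq> {} \<longrightarrow> setdist \<Omega> {0} > 0"
  obtains d R where "0 < d" "d \<le> R" "\<And>x. x \<in> \<Omega> \<Longrightarrow> d \<le> norm x \<and> norm x \<le> R"
proof (cases "\<Omega> = {}")
  case True
  then show ?thesis using that[of 1 1] by simp
next
  case False
  obtain R where R: "\<And>x. x \<in> \<Omega> \<Longrightarrow> norm x \<le> R" using assms(1) bounded_iff by blast
  have d: "setdist \<Omega> {0} \<le> norm x" if "x \<in> \<Omega>" for x
    using setdist_le_dist[OF that, of 0 "{0}"] by simp
  show ?thesis
  proof (rule that)
    show "0 < setdist \<Omega> {0}" using assms(2) False by simp
    show "setdist \<Omega> {0} \<le> R" using False R d by (meson all_not_in_conv order.trans)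
  qed (use R d in auto)
qed

lemma powr_bounded_on_annulus:
  fixes c d R :: real
  assumes "0 < d" "d \<le> R"
  obtains K where "K > 0" "\<And>s. d \<le> s \<Longrightarrow> s \<le> R \<Longrightarrow> s powr c \<le> K"
proof
  show "d powr c + R powr c > 0" using assms by (simp add: add_pos_pos)
  fix s assume s: "d \<le> s" "s \<le> R"
  show "s powr c \<le> d powr c + R powr c"
  proof (cases "c \<ge> 0")
    case True
    then have "s powr c \<le> R powr c" using s assms by (intro powr_mono2) auto
    then show ?thesis by (simp add: add_increasing)
  next
    case False
    then have "s powr c \<le> d powr c" using s assms by (intro powr_mono2') auto
    then show ?thesis by (simp add: add_increasing2)
  qed
qed

lemma powr_Lipschitz_on_annulus:
  fixes c d R :: real
  assumes "0 < d" "d \<le> R"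
  obtains L where "L \<ge> 0" "\<And>s t. s \<in> {d..R} \<Longrightarrow> t \<in> {d..R} \<Longrightarrow> \<bar>s powr c - t powr c\<bar> \<le> L * \<bar>s - t\<bar>"
proof -
  obtain K where K: "K > 0" "\<And>s. d \<le> s \<Longrightarrow> s \<le> R \<Longrightarrow> s powr (c - 1) \<le> K"
    using powr_bounded_on_annulus[OF assms] by metis
  show ?thesis
  proof
    show "\<bar>c\<bar> * K \<ge> 0" using K(1) by simp
    fix s t assume st: "s \<in> {d..R}" "t \<in> {d..R}"
    have "norm (s powr c - t powr c) \<le> \<bar>c\<bar> * K * norm (s - t)"
    proof (rule field_differentiable_bound[OF _ _ _ st])
      fix z assume z: "z \<in> {d..R}"
      show "((\<lambda>s. s powr c) has_field_derivative c * z powr (c - 1)) (at z within {d..R})"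
        using z assms by (auto intro!: derivative_eq_intros)
      show "norm (c * z powr (c - 1)) \<le> \<bar>c\<bar> * K"
        using z K(2)[of z] by (auto simp: abs_mult intro!: mult_left_mono)
    qed auto
    then show "\<bar>s powr c - t powr c\<bar> \<le> \<bar>c\<bar> * K * \<bar>s - t\<bar>" by simp
  qed
qed

text \<open>
  The power may be singular at the origin, but there \<open>v\<close> vanishes in a whole neighbourhood.
\<close>
lemma continuous_on_norm_powr_scaleR:
  fixes v :: "'a::real_normed_vector \<Rightarrow> 'b::real_normed_vector"
  assumes v: "continuous_on UNIV v" and d: "0 < d" "\<And>x. v x \<noteq> 0 \<Longrightarrow> d \<le> norm x"
  shows "continuous_on UNIV (\<lambda>x. norm x powr c *\<^sub>R v x)"
proof -
  have "continuous_on (- {0}) (\<lambda>x. norm x powr c *\<^sub>R v x)"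
    by (intro continuous_intros continuous_on_subset[OF v] continuous_on_powr) auto
  moreover have "continuous_on (ball 0 d) (\<lambda>x. norm x powr c *\<^sub>R v x)"
  proof (rule continuous_on_eq[of _ "\<lambda>_. 0"])
    fix x assume "x \<in> ball (0::'a) d"
    then have "v x = 0" using d(2)[of x] by fastforce
    then show "0 = norm x powr c *\<^sub>R v x" by simp
  qed auto
  ultimately have "continuous_on (- {0} \<union> ball 0 d) (\<lambda>x. norm x powr c *\<^sub>R v x)"
    by (intro continuous_on_open_Un) auto
  moreover have "- {0} \<union> ball (0::'a) d = UNIV" using d(1) by auto
  ultimately show ?thesis by simp
qed

section \<open>Weighted inequalities on a bounded set away from the origin\<close>

text \<open>
  The case \<open>1/n < 1/p\<close>. The critical exponent \<open>q = 1/p - 1/n\<close> is positive here, so only Lebesgue spaces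
  occur on the left.
\<close>
lemma weighted_Sobolev_integral_range:
  fixes \<Omega> :: "(real^'n::finite) set" and c d R rp rq :: real
  assumes n: "CARD('n) \<ge> 2" and d: "0 < d" "d \<le> R"
    and \<Omega>: "\<And>x. x \<in> \<Omega> \<Longrightarrow> d \<le> norm x \<and> norm x \<le> R"
    and rp: "1 / real CARD('n) < rp" "rp \<le> 1" and rq: "rp - 1 / real CARD('n) \<le> rq"
  shows "\<exists>C>0. \<forall>u\<in>Cc_infinity \<Omega>. X_norm rq UNIV (\<lambda>x. norm x powr c * u x)
    \<le> ennreal C * Lp_seminorm lborel rp (\<lambda>x. ennreal (norm (grad u x)))"
proof -
  define q where "q = rp - 1 / real CARD('n)"
  have q: "0 < q" "q \<le> rq" using rp rq by (simp_all add: q_def)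
  define \<gamma> where "\<gamma> = (real CARD('n) - 1) / (real CARD('n) * rp - 1)"
  have \<gamma>: "\<gamma> > 0"
  proof -
    have "real CARD('n) * (1 / real CARD('n)) < real CARD('n) * rp"
      using n rp(1) by (intro mult_strict_left_mono) auto
    then show ?thesis using n by (simp add: \<gamma>_def)
  qed
  obtain K where K: "K > 0" "\<And>s. d \<le> s \<Longrightarrow> s \<le> R \<Longrightarrow> s powr c \<le> K"
    using powr_bounded_on_annulus[OF d] by metis
  define V where "V = unit_ball_vol (real CARD('n)) * R ^ CARD('n)"
  have V: "emeasure lborel (cball (0::real^'n) R) = ennreal V" "V > 0"
    using d by (simp_all add: V_def emeasure_cball)
  show ?thesis
  proof (intro exI[of _ "K * (V powr (rq - q) * \<gamma>)"] conjI ballI)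
    show "0 < K * (V powr (rq - q) * \<gamma>)" using K V \<gamma> by simp
    fix u :: "real^'n \<Rightarrow> real" assume u: "u \<in> Cc_infinity \<Omega>"
    have [measurable]: "u \<in> borel_measurable borel"
      using Cc_infinity_continuous[OF u] by (rule borel_measurable_continuous_onI)
    have supp: "norm x \<le> R" if "u x \<noteq> 0" for x
      using \<Omega> Cc_infinity_support[OF u that] by blast
    let ?N = "Lp_seminorm lborel rp (\<lambda>x. ennreal (norm (grad u x)))"
    have "X_norm rq UNIV (\<lambda>x. norm x powr c * u x)
        = Lp_seminorm lborel rq (\<lambda>x. ennreal (norm (norm x powr c * u x)))"
      using q by (intro X_norm_eq_Lp_seminorm) auto
    also have "\<dots> \<le> ennreal K * Lp_seminorm lborel rq (\<lambda>x. ennreal \<bar>u x\<bar>)"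
    proof (rule Lp_seminorm_cmult_mono)
      fix x
      show "ennreal (norm (norm x powr c * u x)) \<le> ennreal K * ennreal \<bar>u x\<bar>"
      proof (cases "u x = 0")
        case False
        then have "norm x powr c \<le> K"
          using \<Omega> Cc_infinity_support[OF u False] by (intro K) auto
        then show ?thesis
          using K(1) by (auto simp: abs_mult ennreal_mult[symmetric] intro!: ennreal_leI mult_right_mono)
      qed simp
    qed (use q in auto)
    also have "Lp_seminorm lborel rq (\<lambda>x. ennreal \<bar>u x\<bar>)
       \<le> epow (emeasure lborel (cball (0::real^'n) R)) (rq - q) * Lp_seminorm lborel q (\<lambda>x. ennreal \<bar>u x\<bar>)"
    proof (rule Lp_seminorm_mono_exponent)
      show "ennreal \<bar>u x\<bar> = 0" if "x \<notin> cball 0 R" for x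
        using supp[of x] that by force
    qed (use q in auto)
    also have "Lp_seminorm lborel q (\<lambda>x. ennreal \<bar>u x\<bar>) \<le> ennreal \<gamma> * ?N"
      using Gagliardo_Nirenberg_Sobolev[OF _ Cc_infinity_has_derivative[OF u] Cc_infinity_continuous_grad[OF u] supp, of rp]
        n rp by (simp add: \<gamma>_def q_def)
    finally have "X_norm rq UNIV (\<lambda>x. norm x powr c * u x)
       \<le> ennreal K * (epow (ennreal V) (rq - q) * (ennreal \<gamma> * ?N))"
      by (simp add: V mult_left_mono)
    also have "\<dots> = ennreal (K * (V powr (rq - q) * \<gamma>)) * ?N"
      using K V \<gamma> by (simp add: epow_ennreal_pos ennreal_mult mult.assoc)
    finally show "X_norm rq UNIV (\<lambda>x. norm x powr c * u x) \<le> ennreal (K * (V powr (rq - q) * \<gamma>)) * ?N" .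
  qed
qed

text \<open>
  Morrey's inequality for a point of \<open>\<Omega>\<close> and a point \<open>e\<close> outside of \<open>\<Omega>\<close>, where \<open>u\<close> vanishes. Taking
  \<open>|e| = 2 R\<close> keeps the distance of the two points below \<open>3 R\<close>.
\<close>
lemma sup_le_gradient_supercritical:
  fixes \<Omega> :: "(real^'n::finite) set" and R r :: real
  assumes R: "0 < R" "\<And>x. x \<in> \<Omega> \<Longrightarrow> norm x \<le> R"
    and r: "0 < r" "real CARD('n) * r < 1"
  shows "\<exists>S>0. \<forall>u\<in>Cc_infinity \<Omega>. \<forall>x. ennreal \<bar>u x\<bar> \<le> ennreal S * Lp_seminorm lborel r (\<lambda>x. ennreal (norm (grad u x)))"
proof -
  define C where "C = 4 * unit_ball_vol (real CARD('n)) powr (- r) / (1 - real CARD('n) * r)"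
  have C: "C > 0" using r unit_ball_vol_pos[of "real CARD('n)", THEN less_imp_neq] by (auto simp: C_def)
  obtain e :: "real^'n" where e: "norm e = 2 * R"
    using vector_choose_size[of "2 * R"] R(1) by auto
  show ?thesis
  proof (intro exI[of _ "C * (3 * R) powr (1 - real CARD('n) * r)"] conjI ballI allI)
    show "0 < C * (3 * R) powr (1 - real CARD('n) * r)" using C R(1) by simp
    fix u :: "real^'n \<Rightarrow> real" and x assume u: "u \<in> Cc_infinity \<Omega>"
    let ?N = "Lp_seminorm lborel r (\<lambda>x. ennreal (norm (grad u x)))"
    show "ennreal \<bar>u x\<bar> \<le> ennreal (C * (3 * R) powr (1 - real CARD('n) * r)) * ?N"
    proof (cases "u x = 0")
      case False
      have e0: "u e = 0" using Cc_infinity_support[OF u, of e] R e by force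
      have x: "norm (x - e) \<le> 3 * R"
        using R(2)[OF Cc_infinity_support[OF u False]] norm_triangle_ineq4[of x e] e by linarith
      have "ennreal \<bar>u x - u e\<bar> \<le> ennreal (C * norm (x - e) powr (1 - real CARD('n) * r)) * ?N"
        using Morrey_inequality[OF Cc_infinity_has_derivative[OF u] Cc_infinity_continuous_grad[OF u] r(1), of x e] r
        by (simp add: C_def)
      also have "\<dots> \<le> ennreal (C * (3 * R) powr (1 - real CARD('n) * r)) * ?N"
        using x C r by (intro mult_right_mono ennreal_leI mult_left_mono powr_mono2) auto
      finally show ?thesis using e0 by simp
    qed simp
  qed
qed

text \<open>
  The Hoelder exponent \<open>\<theta> = - n / q\<close> is at most the exponent \<open>\<sigma> = 1 - n / p\<close> of Morrey's inequality. At
  distances up to 1 the seminorm for \<open>\<theta>\<close> is controlled by the one for \<open>\<sigma>\<close>, at larger distances by the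
  supremum. The weight enters through the product rule
  \<open>w(x) - w(y) = |x|\<^sup>c (u(x) - u(y)) + (|x|\<^sup>c - |y|\<^sup>c) u(y)\<close>, with its Lipschitz bound on the annulus in
  the second term; if one of the points lies outside the support of \<open>u\<close>, a single term suffices.
\<close>
lemma weighted_Morrey_hoelder_range:
  fixes \<Omega> :: "(real^'n::finite) set" and c d R rp rq :: real
  assumes d: "0 < d" "d \<le> R" and \<Omega>: "\<And>x. x \<in> \<Omega> \<Longrightarrow> d \<le> norm x \<and> norm x \<le> R"
    and rp: "0 < rp" "real CARD('n) * rp < 1" and rq: "rq < 0" "rp - 1 / real CARD('n) \<le> rq"
  shows "\<exists>C>0. \<forall>u\<in>Cc_infinity \<Omega>. X_norm rq UNIV (\<lambda>x. norm x powr c * u x)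
    \<le> ennreal C * Lp_seminorm lborel rp (\<lambda>x. ennreal (norm (grad u x)))"
proof -
  define n where "n = real CARD('n)"
  have n: "n \<ge> 1" by (simp add: n_def Suc_leI)
  define \<theta> where "\<theta> = - (n * rq)"
  define \<sigma> where "\<sigma> = 1 - n * rp"
  have \<theta>: "0 < \<theta>" "\<theta> \<le> \<sigma>" "\<sigma> < 1"
  proof -
    show "0 < \<theta>" using n rq(1) by (simp add: \<theta>_def mult_pos_neg)
    have "n * (rp - 1 / n) \<le> n * rq" using n rq(2) by (intro mult_left_mono) (auto simp: n_def)
    then show "\<theta> \<le> \<sigma>" using n by (simp add: \<theta>_def \<sigma>_def right_diff_distrib)
    show "\<sigma> < 1" using n rp(1) by (simp add: \<sigma>_def)
  qed
  have ord: "hoelder_order CARD('n) rq = 0"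
    using \<theta> by (intro hoelder_order_eq_0) (simp add: \<theta>_def n_def)
  have ex: "hoelder_exponent CARD('n) rq = \<theta>"
    by (simp add: hoelder_exponent_def ord \<theta>_def n_def)
  obtain K where K: "K > 0" "\<And>s. d \<le> s \<Longrightarrow> s \<le> R \<Longrightarrow> s powr c \<le> K"
    using powr_bounded_on_annulus[OF d] by metis
  obtain L where L: "L \<ge> 0" "\<And>s t. s \<in> {d..R} \<Longrightarrow> t \<in> {d..R} \<Longrightarrow> \<bar>s powr c - t powr c\<bar> \<le> L * \<bar>s - t\<bar>"
    using powr_Lipschitz_on_annulus[OF d] by metis
  obtain S where S: "S > 0" "\<And>u x. u \<in> Cc_infinity \<Omega> \<Longrightarrow>
      ennreal \<bar>u x\<bar> \<le> ennreal S * Lp_seminorm lborel rp (\<lambda>x. ennreal (norm (grad u x)))"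
    using sup_le_gradient_supercritical[of R \<Omega> rp] d \<Omega> rp by force
  define C where "C = 4 * unit_ball_vol n powr (- rp) / (1 - n * rp)"
  have C: "C > 0" using rp unit_ball_vol_pos[of n, THEN less_imp_neq] by (auto simp: C_def n_def)
  define T where "T = K * (C + 2 * S) + L * (2 * R) powr (1 - \<theta>) * S"
  have T: "T > 0" using K S C L by (simp add: T_def add_pos_nonneg)
  show ?thesis
  proof (intro exI[of _ "K * S + T"] conjI ballI)
    show "0 < K * S + T" using K S T by (simp add: add_pos_pos)
    fix u :: "real^'n \<Rightarrow> real" assume u: "u \<in> Cc_infinity \<Omega>"
    define N where "N = Lp_seminorm lborel rp (\<lambda>x. ennreal (norm (grad u x)))"
    define w where "w x = norm x powr c * u x" for x
    note supp = Cc_infinity_support[OF u]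
    have "X_norm rq UNIV w = hoelder_norm 0 \<theta> UNIV w"
      using rq by (simp add: X_norm_def ord ex)
    also have "\<dots> \<le> ennreal (K * S + T) * N"
    proof (cases N)
      case top
      then show ?thesis using K S T by (simp add: ennreal_mult_top add_pos_pos)
    next
      case (real \<nu>)
      have su: "\<bar>u x\<bar> \<le> S * \<nu>" for x
        using S(2)[OF u, of x] S(1) real by (simp add: N_def[symmetric] ennreal_mult[symmetric])
      have mo: "\<bar>u x - u y\<bar> \<le> C * norm (x - y) powr \<sigma> * \<nu>" for x y
      proof -
        have "ennreal \<bar>u x - u y\<bar> \<le> ennreal (C * norm (x - y) powr \<sigma>) * N"
          using Morrey_inequality[OF Cc_infinity_has_derivative[OF u] Cc_infinity_continuous_grad[OF u] rp(1), of x y] rp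
          by (simp add: C_def n_def \<sigma>_def N_def)
        then show ?thesis using C real by (simp add: ennreal_mult[symmetric])
      qed
      have ho: "\<bar>u x - u y\<bar> \<le> (C + 2 * S) * norm (x - y) powr \<theta> * \<nu>" for x y
      proof (cases "norm (x - y) \<le> 1")
        case True
        have "norm (x - y) powr \<sigma> \<le> norm (x - y) powr \<theta>"
          using True \<theta> by (cases "x = y") (auto intro!: powr_mono')
        then have "C * norm (x - y) powr \<sigma> * \<nu> \<le> (C + 2 * S) * norm (x - y) powr \<theta> * \<nu>"
          using C S(1) real by (intro mult_right_mono mult_mono) auto
        with mo[of x y] show ?thesis by linarith
      next
        case False
        have "\<bar>u x - u y\<bar> \<le> (2 * S) * 1 * \<nu>" using su[of x] su[of y] by linarith
        also have "\<dots> \<le> (C + 2 * S) * norm (x - y) powr \<theta> * \<nu>"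
          using C S(1) real False \<theta> by (intro mult_right_mono mult_mono) (auto simp: ge_one_powr_ge_zero)
        finally show ?thesis .
      qed
      have wle: "\<bar>w x\<bar> \<le> K * S * \<nu>" for x
      proof (cases "u x = 0")
        case False
        then have "norm x powr c \<le> K" using \<Omega> supp by (intro K) auto
        then show ?thesis using su[of x] K(1) by (simp add: w_def abs_mult mult.assoc mult_mono)
      next
        case True then show ?thesis using K S real by (simp add: w_def)
      qed
      have one: "\<bar>norm x powr c * (u x - u y)\<bar> \<le> K * (C + 2 * S) * norm (x - y) powr \<theta> * \<nu>" if "x \<in> \<Omega>" for x y
      proof -
        have "norm x powr c \<le> K" using \<Omega>[OF that] by (intro K) auto
        then have "norm x powr c * \<bar>u x - u y\<bar> \<le> K * ((C + 2 * S) * norm (x - y) powr \<theta> * \<nu>)"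
          using ho[of x y] K(1) by (intro mult_mono) auto
        then show ?thesis by (simp add: abs_mult mult.assoc)
      qed
      have wh: "\<bar>w x - w y\<bar> \<le> T * norm (x - y) powr \<theta> * \<nu>" for x y
      proof -
        have KT: "K * (C + 2 * S) * norm (x - y) powr \<theta> * \<nu> \<le> T * norm (x - y) powr \<theta> * \<nu>"
          using L S real unfolding T_def by (intro mult_right_mono) auto
        consider "x \<in> \<Omega>" "y \<in> \<Omega>" | "x \<in> \<Omega>" "u y = 0" | "y \<in> \<Omega>" "u x = 0" | "u x = 0" "u y = 0"
          using supp by blast
        then show ?thesis
        proof cases
          case 1
          have nx: "norm x \<in> {d..R}" "norm y \<in> {d..R}" using \<Omega> 1 by auto
          have "norm (x - y) \<le> 2 * R" using nx norm_triangle_ineq4[of x y] by auto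
          have "\<bar>norm x powr c - norm y powr c\<bar> \<le> L * \<bar>norm x - norm y\<bar>"
            by (rule L(2)[OF nx])
          also have "\<dots> \<le> L * norm (x - y)"
            using L(1) by (intro mult_left_mono norm_triangle_ineq3)
          also have "norm (x - y) = norm (x - y) powr (1 - \<theta>) * norm (x - y) powr \<theta>"
            by (cases "x = y") (simp_all add: powr_add[symmetric])
          also have "L * \<dots> \<le> L * ((2 * R) powr (1 - \<theta>) * norm (x - y) powr \<theta>)"
            using \<open>norm (x - y) \<le> 2 * R\<close> \<theta> L(1) by (intro mult_left_mono mult_right_mono powr_mono2) auto
          finally have f: "\<bar>norm x powr c - norm y powr c\<bar> \<le> L * ((2 * R) powr (1 - \<theta>) * norm (x - y) powr \<theta>)" .
          have "w x - w y = norm x powr c * (u x - u y) + (norm x powr c - norm y powr c) * u y"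
            by (simp add: w_def algebra_simps)
          then have "\<bar>w x - w y\<bar> \<le> \<bar>norm x powr c * (u x - u y)\<bar> + \<bar>norm x powr c - norm y powr c\<bar> * \<bar>u y\<bar>"
            by (metis abs_mult abs_triangle_ineq)
          also have "\<dots> \<le> K * (C + 2 * S) * norm (x - y) powr \<theta> * \<nu> + L * ((2 * R) powr (1 - \<theta>) * norm (x - y) powr \<theta>) * (S * \<nu>)"
            using one[OF 1(1), of y] f su[of y] L(1) by (intro add_mono mult_mono) auto
          also have "\<dots> = T * norm (x - y) powr \<theta> * \<nu>"
            by (simp add: T_def algebra_simps)
          finally show ?thesis .
        next
          case 2
          then show ?thesis using one[of x y] KT by (simp add: w_def)
        next
          case 3
          then show ?thesis using one[of y x] KT by (simp add: w_def norm_minus_commute abs_mult)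
        next
          case 4
          then show ?thesis using T real by (simp add: w_def)
        qed
      qed
      have "(SUP x\<in>UNIV. ennreal (norm (w x))) \<le> ennreal (K * S * \<nu>)"
        using wle by (intro SUP_least ennreal_leI) simp
      moreover have "(SUP (x, y)\<in>{(x, y). x \<in> UNIV \<and> y \<in> UNIV \<and> x \<noteq> y}. ennreal (norm (w x - w y) / norm (x - y) powr \<theta>)) \<le> ennreal (T * \<nu>)"
      proof (intro SUP_least, clarify, intro ennreal_leI)
        fix x y :: "real^'n" assume "x \<noteq> y"
        then show "norm (w x - w y) / norm (x - y) powr \<theta> \<le> T * \<nu>"
          using wh[of x y] by (simp add: pos_divide_le_eq mult_ac)
      qed
      ultimately have "hoelder_norm 0 \<theta> UNIV w \<le> ennreal (K * S * \<nu>) + ennreal (T * \<nu>)"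
        unfolding hoelder_norm_0 by (rule add_mono)
      also have "\<dots> = ennreal (K * S + T) * N"
        using K S T real by (simp add: ennreal_mult[symmetric] ennreal_plus[symmetric] distrib_right del: ennreal_plus)
      finally show ?thesis .
    qed
    finally show "X_norm rq UNIV (\<lambda>x. norm x powr c * u x) \<le> ennreal (K * S + T) * Lp_seminorm lborel rp (\<lambda>x. ennreal (norm (grad u x)))"
      by (simp add: w_def[abs_def] N_def)
  qed
qed

text \<open>On a bounded support the supremum dominates every Lebesgue norm.\<close>
lemma weighted_Morrey_integral_range:
  fixes \<Omega> :: "(real^'n::finite) set" and c d R rp rq :: real
  assumes d: "0 < d" "d \<le> R" and \<Omega>: "\<And>x. x \<in> \<Omega> \<Longrightarrow> d \<le> norm x \<and> norm x \<le> R"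
    and rp: "0 < rp" "real CARD('n) * rp < 1" and rq: "0 \<le> rq"
  shows "\<exists>C>0. \<forall>u\<in>Cc_infinity \<Omega>. X_norm rq UNIV (\<lambda>x. norm x powr c * u x)
    \<le> ennreal C * Lp_seminorm lborel rp (\<lambda>x. ennreal (norm (grad u x)))"
proof -
  obtain K where K: "K > 0" "\<And>s. d \<le> s \<Longrightarrow> s \<le> R \<Longrightarrow> s powr c \<le> K"
    using powr_bounded_on_annulus[OF d] by metis
  obtain S where S: "S > 0" "\<And>u x. u \<in> Cc_infinity \<Omega> \<Longrightarrow>
      ennreal \<bar>u x\<bar> \<le> ennreal S * Lp_seminorm lborel rp (\<lambda>x. ennreal (norm (grad u x)))"
    using sup_le_gradient_supercritical[of R \<Omega> rp] d \<Omega> rp by force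
  define V where "V = unit_ball_vol (real CARD('n)) * R ^ CARD('n)"
  have V: "emeasure lborel (cball (0::real^'n) R) = ennreal V" "V > 0"
    using d by (simp_all add: V_def emeasure_cball)
  show ?thesis
  proof (intro exI[of _ "K * S * V powr rq"] conjI ballI)
    show "0 < K * S * V powr rq" using K S V by simp
    fix u :: "real^'n \<Rightarrow> real" assume u: "u \<in> Cc_infinity \<Omega>"
    define N where "N = Lp_seminorm lborel rp (\<lambda>x. ennreal (norm (grad u x)))"
    define w where "w x = norm x powr c * u x" for x
    have wm: "w \<in> borel_measurable borel"
    proof -
      have [measurable]: "u \<in> borel_measurable borel"
        using Cc_infinity_continuous[OF u] by (rule borel_measurable_continuous_onI)
      show ?thesis unfolding w_def[abs_def] by measurable
    qed
    have w: "ennreal (norm (w x)) \<le> (ennreal (K * S) * N) * indicator (cball 0 R) x" for x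
    proof (cases "u x = 0")
      case False
      then have x: "d \<le> norm x" "norm x \<le> R" using \<Omega> Cc_infinity_support[OF u] by blast+
      have "ennreal (norm (w x)) = ennreal (norm x powr c) * ennreal \<bar>u x\<bar>"
        by (simp add: w_def abs_mult ennreal_mult)
      also have "\<dots> \<le> ennreal K * (ennreal S * N)"
        unfolding N_def using K(2)[OF x] by (intro mult_mono S(2)[OF u] ennreal_leI) auto
      finally show ?thesis using x K S by (simp add: ennreal_mult mult.assoc)
    qed (simp add: w_def)
    have "X_norm rq UNIV w \<le> ennreal (K * S * V powr rq) * N"
    proof (cases "rq = 0")
      case True
      have "Linf_norm UNIV w \<le> ennreal (K * S) * N"
        unfolding Linf_norm_def
      proof (rule esssup_I)
        show "(\<lambda>x. ennreal (norm (w x))) \<in> borel_measurable (lebesgue_on UNIV)"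
          using wm by (simp add: lebesgue_on_UNIV_eq measurable_completion)
        show "AE x in lebesgue_on UNIV. ennreal (norm (w x)) \<le> ennreal (K * S) * N"
          using w by (intro AE_I2) (metis indicator_simps mult.right_neutral mult_zero_right zero_le order.trans)
      qed
      then show ?thesis using True V by (simp add: X_norm_def)
    next
      case False
      then have rq': "rq > 0" using rq by simp
      have "X_norm rq UNIV w = Lp_seminorm lborel rq (\<lambda>x. ennreal (norm (w x)))"
        by (rule X_norm_eq_Lp_seminorm[OF rq'])
      also have "\<dots> \<le> (ennreal (K * S) * N) * Lp_seminorm lborel rq (indicator (cball (0::real^'n) R))"
        using w rq' by (intro Lp_seminorm_cmult_mono borel_measurable_indicator) auto
      also have "Lp_seminorm lborel rq (indicator (cball (0::real^'n) R)) = ennreal (V powr rq)"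
        using V rq' by (simp add: Lp_seminorm_indicator epow_ennreal_pos)
      finally show ?thesis using K S V by (simp add: ennreal_mult mult_ac)
    qed
    then show "X_norm rq UNIV (\<lambda>x. norm x powr c * u x) \<le> ennreal (K * S * V powr rq) * Lp_seminorm lborel rp (\<lambda>x. ennreal (norm (grad u x)))"
      by (simp add: w_def[abs_def] N_def)
  qed
qed

theorem theorem1p2:
  fixes \<Omega> :: "(real^'n::finite) set" and a b rp rq :: real
  assumes "CARD('n) \<ge> 2"
    and "open \<Omega>" and "bounded \<Omega>" and "\<Omega> \<subseteq> UNIV - {0}"
    and "\<Omega> \<noteq> {} \<longrightarrow> setdist \<Omega> {0} > 0"
    and "rp \<in> {0<..<1 / real CARD('n)} \<union> {1 / real CARD('n)<..1}"
    and "rq \<in> {rp - 1 / real CARD('n)..rp}"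
    and "rq - b / real CARD('n) = rp - (1 + a) / real CARD('n)"
  shows "\<exists>C::real. C > 0 \<and>
    (\<forall>u. u \<in> Cc_infinity \<Omega> \<and> u \<in> WX_space 1 rp a UNIV \<longrightarrow>
      u \<in> WX_space 0 rq b UNIV \<and>
      X_norm rq UNIV (\<lambda>x. norm x powr (-b) * u x)
        \<le> ennreal C * X_norm rp UNIV (\<lambda>x. norm x powr (-a) *\<^sub>R grad u x))"
proof -
  define n where "n = real CARD('n)"
  have n: "n > 0" by (simp add: n_def)
  obtain d R where d: "0 < d" "d \<le> R" and \<Omega>: "\<And>x. x \<in> \<Omega> \<Longrightarrow> d \<le> norm x \<and> norm x \<le> R"
    using bounded_away_from_0_annulus[OF assms(3,5)] by metis
  have rp: "0 < rp"
    using assms(6) n by (auto simp: n_def[symmetric] intro: less_trans[of 0 "1 / n"])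
  have "\<exists>C>0. \<forall>u\<in>Cc_infinity \<Omega>. X_norm rq UNIV (\<lambda>x. norm x powr (-b) * u x)
    \<le> ennreal C * Lp_seminorm lborel rp (\<lambda>x. ennreal (norm (grad u x)))"
  proof (cases "1 / n < rp")
    case True
    then show ?thesis
      using weighted_Sobolev_integral_range[OF assms(1) d \<Omega>, where rp=rp and rq=rq and c="-b"] assms(6,7) by (auto simp: n_def)
  next
    case False
    then have rp': "real CARD('n) * rp < 1" using assms(6) n by (auto simp: n_def field_simps)
    show ?thesis
    proof (cases "rq < 0")
      case True
      then show ?thesis
        using weighted_Morrey_hoelder_range[OF d \<Omega> rp rp' True, where c="-b"] assms(7) by auto
    next
      case False
      then show ?thesis
        using weighted_Morrey_integral_range[OF d \<Omega> rp rp', where rq=rq and c="-b"] by auto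
    qed
  qed
  then obtain C where C: "C > 0" "\<And>u. u \<in> Cc_infinity \<Omega> \<Longrightarrow> X_norm rq UNIV (\<lambda>x. norm x powr (-b) * u x)
    \<le> ennreal C * Lp_seminorm lborel rp (\<lambda>x. ennreal (norm (grad u x)))" by blast
  (* K removes the weight on the gradient: |Du| = |x| powr a * (|x| powr (-a) * |Du|) on \<Omega>. *)
  obtain K where K: "K > 0" "\<And>s. d \<le> s \<Longrightarrow> s \<le> R \<Longrightarrow> s powr a \<le> K"
    using powr_bounded_on_annulus[OF d] by metis
  show ?thesis
  proof (intro exI[of _ "C * K"] conjI allI impI; (elim conjE)?)
    show "0 < C * K" using C K by simp
    fix u :: "real^'n \<Rightarrow> real" assume u: "u \<in> Cc_infinity \<Omega>"
    let ?w = "\<lambda>x. norm x powr (-b) * u x" and ?g = "\<lambda>x. norm x powr (-a) *\<^sub>R grad u x"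
    have gc: "continuous_on UNIV ?g"
      using Cc_infinity_grad_support[OF u] \<Omega>
      by (intro continuous_on_norm_powr_scaleR[OF Cc_infinity_continuous_grad[OF u] d(1)]) blast
    have wc: "continuous_on UNIV ?w"
      using continuous_on_norm_powr_scaleR[OF Cc_infinity_continuous[OF u] d(1), of "-b"]
        Cc_infinity_support[OF u] \<Omega> by force
    have [measurable]: "?g \<in> borel_measurable borel"
      using gc by (rule borel_measurable_continuous_onI)
    have N: "X_norm rp UNIV ?g = Lp_seminorm lborel rp (\<lambda>x. ennreal (norm (?g x)))"
      by (rule X_norm_eq_Lp_seminorm[OF rp])
    have "Lp_seminorm lborel rp (\<lambda>x. ennreal (norm (grad u x))) \<le> ennreal K * X_norm rp UNIV ?g"
      unfolding N
    proof (rule Lp_seminorm_cmult_mono[OF _ _ rp])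
      fix x
      show "ennreal (norm (grad u x)) \<le> ennreal K * ennreal (norm (?g x))"
      proof (cases "grad u x = 0")
        case False
        then have x: "d \<le> norm x" "norm x \<le> R" using \<Omega> Cc_infinity_grad_support[OF u] by blast+
        have "x \<noteq> 0" using x d by auto
        then have "norm x powr a * norm x powr (-a) = 1"
          by (simp add: powr_add[symmetric])
        then have "norm (grad u x) = norm x powr a * norm (?g x)"
          by (simp add: mult.assoc[symmetric])
        also have "\<dots> \<le> K * norm (?g x)" using K(2)[OF x] by (intro mult_right_mono) auto
        finally show ?thesis using K(1) by (simp add: ennreal_mult[symmetric] ennreal_leI)
      qed simp
    qed measurable
    then have "ennreal C * Lp_seminorm lborel rp (\<lambda>x. ennreal (norm (grad u x))) \<le> ennreal C * (ennreal K * X_norm rp UNIV ?g)"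
      by (rule mult_left_mono) simp
    with C(2)[OF u] show le: "X_norm rq UNIV ?w \<le> ennreal (C * K) * X_norm rp UNIV ?g"
      using C(1) K(1) by (simp add: ennreal_mult mult.assoc)
    (* Membership in the weighted space is a matter of finiteness, and the right-hand side is finite
       because the weighted gradient is continuous with bounded support. *)
    have "(\<integral>\<^sup>+x. epow (ennreal (norm (?g x))) (1 / rp) \<partial>lborel) < top"
    proof (rule nn_integral_epow_bounded_support_finite[OF gc])
      show "norm x \<le> R" if "?g x \<noteq> 0" for x
        using that \<Omega> Cc_infinity_grad_support[OF u, of x] by auto
    qed (use rp in simp)
    then have "X_norm rp UNIV ?g < top"
      unfolding N Lp_seminorm_def using rp by (simp add: epow_eq_top_iff less_top[symmetric])
    then have "ennreal (C * K) * X_norm rp UNIV ?g < top"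
      by (simp add: ennreal_mult_less_top)
    with le have fin: "X_norm rq UNIV ?w < top"
      by (rule order_le_less_trans)
    show "u \<in> WX_space 0 rq b UNIV"
    proof (rule WX_space_0I[OF Cc_infinity_continuous[OF u]])
      have "?w \<in> borel_measurable (lebesgue_on UNIV)"
        using wc by (simp add: lebesgue_on_UNIV_eq measurable_completion borel_measurable_continuous_onI)
      moreover have "hoelder_order CARD('n) rq = 0" if "rq < 0"
      proof -
        have "n * (rp - 1 / n) \<le> n * rq" using assms(7) n by (intro mult_left_mono) (auto simp: n_def)
        then have "n * rq + 1 \<ge> n * rp" using n by (simp add: right_diff_distrib)
        moreover have "n * rp > 0" using n rp by simp
        ultimately show ?thesis by (intro hoelder_order_eq_0) (simp add: n_def)
      qed
      ultimately show "?w \<in> X_space rq UNIV"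
        using fin wc by (auto simp: X_space_def)
    qed
  qed
qed

end
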